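(* Let $\Gamma$ be a connected planar graph. For any integers $r\geq 2$ and $k\geq 4$, we have the inequality \[\mathrm{TC}_r(\mathrm{Conf}_k(\Gamma))\geq r\min\left\{\left\lfloor\frac{k}{2}\right\rfloor,\, m(\Gamma)\right\}.\]
   Context: A graph is a finite CW complex of dimension $1$. It is planar if it admits a topological embedding in $\mathbb{R}^2$. An essential vertex of a graph is a vertex of valence at least $3$ (a loop at a vertex contributes $2$ to its valence), and $m(\Gamma)$ denotes the number of essential vertices of $\Gamma$. For a space $X$, the ordered configuration space is $\mathrm{Conf}_k(X)=\{(x_1,\ldots,x_k)\in X^k: x_i\neq x_j \text{ if } i\neq j\}$, topologized as a subspace of $X^k$. For $r\geq 2$, the $r$th topological complexity $\mathrm{TC}_r(X)$ is one less than the minimal cardinality of an open cover $\mathcal{U}$ of $X^r$ such that the map $X^{[0,1]}\to X^r$, $\gamma\mapsto\left(\gamma\left(\tfrac{0}{r-1}\right),\gamma\left(\tfrac{1}{r-1}\right),\ldots,\gamma\left(\tfrac{r-1}{r-1}\right)\right)$, admits a continuous local section over each member of $\mathcal{U}$ ($X^{[0,1]}$ carries the compact-open topology; the value is $\infty$ if there is no finite such cover). With this convention, the topological complexity of a point is $0$. *)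

theory Defs
  imports "HOL-Analysis.Analysis" "HOL-Library.Extended_Nat"
begin

text \<open>A finite CW complex of dimension 1, as a cell structure on a Hausdorff space \<open>X\<close>: the
  0-cells are the points of \<open>V\<close>, and \<open>\<phi> e\<close> is the characteristic map of the
  1-cell \<open>e \<in> E\<close>, with \<open>D\<^sup>1\<close> parametrised as \<open>[0,1]\<close>. Two CW axioms are not listed because
  finiteness implies them: closure-finiteness, and the weak topology (\<open>X\<close> is a finite union of
  compact, hence closed, closed cells). Multiple edges and loops are allowed. Since the dimension
  is exactly 1, there is at least one 1-cell; in particular \<open>X\<close> is nonempty.\<close>

locale cw_graph =
  fixes X :: "'a topology" and V :: "'a set" and E :: "'e set" and \<phi> :: "'e \<Rightarrow> real \<Rightarrow> 'a"
  assumes Hausdorff: "Hausdorff_space X"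
    and finite_vertices: "finite V"
    and finite_edges: "finite E"
    and dimension_one: "E \<noteq> {}"
    and char_map_continuous: "\<And>e. e \<in> E \<Longrightarrow> continuous_map (top_of_set {0..1}) X (\<phi> e)"
    and char_map_homeo: "\<And>e. e \<in> E \<Longrightarrow>
          homeomorphic_map (top_of_set {0<..<1}) (subtopology X (\<phi> e ` {0<..<1})) (\<phi> e)"
    and attaching: "\<And>e. e \<in> E \<Longrightarrow> \<phi> e 0 \<in> V \<and> \<phi> e 1 \<in> V"
    and vertices_disjoint_edges: "\<And>e. e \<in> E \<Longrightarrow> V \<inter> \<phi> e ` {0<..<1} = {}"
    and edges_disjoint: "disjoint_family_on (\<lambda>e. \<phi> e ` {0<..<1}) E"
    and cells_cover: "V \<union> (\<Union>e\<in>E. \<phi> e ` {0<..<1}) = topspace X"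

text \<open>Counting both ends of every edge makes a loop contribute 2.\<close>

definition valence :: "'e set \<Rightarrow> ('e \<Rightarrow> real \<Rightarrow> 'a) \<Rightarrow> 'a \<Rightarrow> nat" where
  "valence E \<phi> v = card {e \<in> E. \<phi> e 0 = v} + card {e \<in> E. \<phi> e 1 = v}"

definition essential_vertices :: "'a set \<Rightarrow> 'e set \<Rightarrow> ('e \<Rightarrow> real \<Rightarrow> 'a) \<Rightarrow> 'a set" where
  "essential_vertices V E \<phi> = {v \<in> V. valence E \<phi> v \<ge> 3}"

definition planar :: "'a topology \<Rightarrow> bool" where
  "planar X \<longleftrightarrow> (\<exists>f :: 'a \<Rightarrow> real ^ 2. embedding_map X euclidean f)"

text \<open>Points of \<open>X\<^sup>n\<close> are indexed by \<open>{..<n}\<close> (shifting the indices \<open>1, \<dots>, n\<close> by one) and are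
  \<open>undefined\<close> outside, as usual for \<^const>\<open>product_topology\<close>.\<close>

definition power_topology :: "nat \<Rightarrow> 'a topology \<Rightarrow> (nat \<Rightarrow> 'a) topology" where
  "power_topology n X = product_topology (\<lambda>_. X) {..<n}"

definition Conf :: "nat \<Rightarrow> 'a topology \<Rightarrow> (nat \<Rightarrow> 'a) topology" where
  "Conf k X = subtopology (power_topology k X) {x. inj_on x {..<k}}"

text \<open>A continuous map \<open>Y \<rightarrow> X\<close> is represented by the unique function that is \<open>undefined\<close> outside
  \<open>topspace Y\<close>, so that equal maps are equal functions.\<close>

definition map_space :: "'b topology \<Rightarrow> 'a topology \<Rightarrow> ('b \<Rightarrow> 'a) set" where
  "map_space Y X = {f \<in> extensional (topspace Y). continuous_map Y X f}"

definition compact_open_topology :: "'b topology \<Rightarrow> 'a topology \<Rightarrow> ('b \<Rightarrow> 'a) topology" where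
  "compact_open_topology Y X =
     topology_generated_by {{f \<in> map_space Y X. f ` K \<subseteq> U} | K U. compactin Y K \<and> openin X U}"

lemma topspace_compact_open_topology [simp]:
  "topspace (compact_open_topology Y X) = map_space Y X"
proof -
  have "{f \<in> map_space Y X. f ` {} \<subseteq> {}}
      \<in> {{f \<in> map_space Y X. f ` K \<subseteq> U} | K U. compactin Y K \<and> openin X U}"
    by (intro CollectI exI[of _ "{}"] conjI) auto
  then show ?thesis
    unfolding compact_open_topology_def topology_generated_by_topspace by auto
qed

definition path_space :: "'a topology \<Rightarrow> (real \<Rightarrow> 'a) topology" where
  "path_space X = compact_open_topology (top_of_set {0..1}) X"

definition path_eval :: "nat \<Rightarrow> (real \<Rightarrow> 'a) \<Rightarrow> nat \<Rightarrow> 'a" where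
  "path_eval r \<gamma> = (\<lambda>j\<in>{..<r}. \<gamma> (real j / (real r - 1)))"

definition has_local_section :: "nat \<Rightarrow> 'a topology \<Rightarrow> (nat \<Rightarrow> 'a) set \<Rightarrow> bool" where
  "has_local_section r X U \<longleftrightarrow>
     (\<exists>s. continuous_map (subtopology (power_topology r X) U) (path_space X) s \<and>
          (\<forall>x\<in>U. path_eval r (s x) = x))"

text \<open>The infimum is \<open>\<infinity>\<close> if there is no finite cover, and \<open>\<infinity> - 1 = \<infinity>\<close>. The subtraction is
  truncated only for the empty space, whose product is covered by the empty family.\<close>

definition TC :: "nat \<Rightarrow> 'a topology \<Rightarrow> enat" where
  "TC r X =
     Inf {enat (card \<U>) | \<U>. finite \<U> \<and> \<Union>\<U> = topspace (power_topology r X) \<and>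
            (\<forall>U\<in>\<U>. openin (power_topology r X) U \<and> has_local_section r X U)} - 1"

end

theory Submission
  imports Defs
begin

text \<open>
  Put \<open>m = min (k div 2) (card (essential_vertices V E \<phi>))\<close>. Two particles near an essential vertex can
  turn around each other: they occupy two of three legs and give way on the third one. Hence any \<open>m\<close>
  disjoint pairs of particles, sent to \<open>m\<close> different essential vertices, define a torus of
  dimension \<open>m\<close> in the configuration space, with the other particles parked. An embedding of the graph
  in the plane turns the displacement of two particles \<open>a\<close> and \<open>b\<close> into a map to \<open>\<complex> - {0}\<close>,
  that is, into a class \<open>\<alpha>\<^sub>a\<^sub>b\<close> in the first cohomology of the configuration space. On the torus, the class of
  a pair is an odd multiple of a coordinate class, because a half turn exchanges the two particles
  and so negates the displacement (\<open>displacement_matched\<close>). The class of two particles that do not form a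
  pair vanishes, because they move in disjoint contractible sets (\<open>displacement_unmatched\<close>).

  Choose two sets of \<open>m\<close> pairs without a common pair, which give tori \<open>T\<close> and \<open>T'\<close>. On the torus
  \<open>T \<times> T' \<times> \<dots> \<times> T'\<close> of dimension \<open>r * m\<close> in the \<open>r\<close>th power of the configuration space, compare the
  class of a pair on the factor where this pair rotates with the same class on a factor where it does
  not. The \<open>r * m\<close> zero-divisors so obtained restrict to nonzero multiples of the \<open>r * m\<close>
  coordinate classes, and their product does not vanish. By the usual zero-divisor argument, \<open>TC r\<close> is at
  least \<open>r * m\<close>.

  The proof below avoids cohomology. A section over an open set \<open>U\<close> makes the zero-divisors vanish on \<open>U\<close>
  in the concrete sense that the coordinate in question lifts to a real function on the part of the torus
  over \<open>U\<close> (\<open>TC_lower_bound_from_torus\<close>), and Kuhn's lemma, the combinatorial core of Brouwer's fixed point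
  theorem, shows that a torus of dimension \<open>n\<close> is not covered by \<open>n\<close> open sets, one for each
  coordinate, on which that coordinate lifts (\<open>torus_cover_obstruction\<close>).
\<close>

section \<open>Covers of the torus\<close>

lemma dist_fun_le_of_coordinates:
  fixes x y :: "nat \<Rightarrow> real"
  assumes "\<And>j. \<bar>x j - y j\<bar> \<le> d"
  shows "dist x y \<le> 2 * d + (1/2) ^ N"
proof -
  have "Max {dist (x (from_nat n)) (y (from_nat n)) |n. n \<le> N} \<le> d"
    by (rule Max.boundedI) (auto simp: dist_real_def assms)
  then show ?thesis
    using dist_fun_le_dist_first_terms[of x y N] by linarith
qed

text \<open>The torus \<open>(\<real>/\<int>)\<^sup>n\<close> is not covered by \<open>n\<close> open sets such that the \<open>i\<close>th coordinate lifts to a real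
function on the \<open>i\<close>th of them; this is the torus case of the cup-length bound for the
Lusternik--Schnirelmann category. Everything is stated on the universal cover, where \<open>lam i\<close> is the lift of a
map of degree one applied to the \<open>i\<close>th coordinate. The periodic function \<open>h i\<close> is a lift over \<open>W i\<close> in the
sense that it differs from \<open>lam i\<close> by an amount that does not change along segments in \<open>W i\<close>.

By the Lebesgue number lemma, the cells of a fine grid lie each in some \<open>W i\<close>. A grid point has
\<open>i\<close>th label \<open>1\<close> if \<open>lam i - h i\<close> exceeds a bound \<open>B\<close> there; the label is thus constant on the cells in \<open>W i\<close>. On
the other hand \<open>h i\<close> takes finitely many values at grid points, because it is periodic, while \<open>lam i\<close>
grows without bound; so on a large cube the label is \<open>0\<close> on one face and \<open>1\<close> on the opposite one.
Kuhn's combinatorial lemma then yields a cell on which every label takes both values, and this cell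
cannot lie in any \<open>W i\<close>.\<close>

lemma torus_cover_obstruction:
  fixes n :: nat and W :: "nat \<Rightarrow> (nat \<Rightarrow> real) set"
    and h :: "nat \<Rightarrow> (nat \<Rightarrow> real) \<Rightarrow> real" and lam :: "nat \<Rightarrow> real \<Rightarrow> real"
  assumes W_open: "\<And>i. i < n \<Longrightarrow> open (W i)"
    and W_cover: "\<And>x. \<exists>i<n. x \<in> W i"
    and W_periodic: "\<And>i x z. \<lbrakk>i < n; x \<in> W i; \<And>j. z j \<in> \<int>\<rbrakk> \<Longrightarrow> (\<lambda>j. x j + z j) \<in> W i"
    and h_periodic: "\<And>i x z. \<lbrakk>i < n; \<And>j. z j \<in> \<int>\<rbrakk> \<Longrightarrow> h i (\<lambda>j. x j + z j) = h i x"
    and lam_shift: "\<And>i t. i < n \<Longrightarrow> lam i (t + 1) = lam i t + 1"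
    and segment: "\<And>i x y. \<lbrakk>i < n; \<And>\<tau>. \<lbrakk>0 \<le> \<tau>; \<tau> \<le> 1\<rbrakk> \<Longrightarrow> (\<lambda>j. (1 - \<tau>) * x j + \<tau> * y j) \<in> W i\<rbrakk>
          \<Longrightarrow> lam i (x i) - h i x = lam i (y i) - h i y"
  shows False
proof -
  define K where "K = {x :: nat \<Rightarrow> real. \<forall>j. x j \<in> {0..1}}"
  have "compactin (product_topology (\<lambda>_. euclideanreal) UNIV) (PiE UNIV (\<lambda>_::nat. {0..1::real}))"
    by (subst compactin_PiE) auto
  then have "compact K"
    unfolding K_def euclidean_product_topology compactin_euclidean_iff by (simp add: PiE_UNIV_domain Pi_def)
  have n_pos: "n > 0"
    using W_cover by fastforce
  obtain \<delta> where "\<delta> > 0" and \<delta>: "\<And>T. \<lbrakk>T \<subseteq> K; diameter T < \<delta>\<rbrakk> \<Longrightarrow> \<exists>B \<in> W ` {..<n}. T \<subseteq> B"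
  proof (rule Lebesgue_number_lemma[of K "W ` {..<n}"])
    show "W ` {..<n} \<noteq> {}" "K \<subseteq> \<Union> (W ` {..<n})"
      using n_pos W_cover by auto
  qed (use \<open>compact K\<close> W_open in auto)
  obtain N where N: "(1/2::real) ^ N < \<delta> / 4"
    using real_arch_pow_inv[of "\<delta> / 4" "1/2"] \<open>\<delta> > 0\<close> by auto
  obtain M0 :: nat where M0: "8 / \<delta> < real M0"
    using reals_Archimedean2 by blast
  define M where "M = Suc M0"
  have M_pos: "real M > 0" by (simp add: M_def)
  have "8 / \<delta> < real M"
    using M0 by (simp add: M_def)
  then have M_small: "2 * (1 / real M) < \<delta> / 4"
    using \<open>\<delta> > 0\<close> M_pos by (simp add: field_simps)
  define Cell where "Cell q = {x :: nat \<Rightarrow> real.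
     (\<forall>j<n. real (q j) / M \<le> x j \<and> x j \<le> (real (q j) + 1) / M) \<and> (\<forall>j\<ge>n. x j = 0)}" for q :: "nat \<Rightarrow> nat"
  define g where "g q = (\<lambda>j. if j < n then real (q j) / M else 0)" for q :: "nat \<Rightarrow> nat"

  have quotient: "real a / M = real (a mod M) / M + real (a div M)" for a
  proof -
    have "real a = real (a mod M) + real M * real (a div M)"
      by (metis mod_mult_div_eq of_nat_add of_nat_mult)
    then show ?thesis using M_pos by (simp add: field_simps)
  qed
  have small_cell: "\<exists>i<n. Cell q \<subseteq> W i" if q: "\<And>j. j < n \<Longrightarrow> q j < M" for q
  proof -
    have "x \<in> K" if x: "x \<in> Cell q" for x
      unfolding K_def mem_Collect_eq
    proof
      fix j
      show "x j \<in> {0..1}"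
      proof (cases "j < n")
        case True
        have "real (q j) + 1 \<le> M" using q[OF True] by linarith
        then have "(real (q j) + 1) / M \<le> 1" using M_pos by simp
        moreover have "0 \<le> real (q j) / M" by simp
        moreover have "real (q j) / M \<le> x j" "x j \<le> (real (q j) + 1) / M"
          using x True by (simp_all add: Cell_def)
        ultimately show ?thesis unfolding atLeastAtMost_iff by linarith
      qed (use x in \<open>auto simp: Cell_def\<close>)
    qed
    moreover have "diameter (Cell q) \<le> 2 * (1 / real M) + (1/2) ^ N"
    proof -
     have "dist x y \<le> 2 * (1 / real M) + (1/2) ^ N" if xy: "x \<in> Cell q" "y \<in> Cell q" for x y
     proof -
      have "\<bar>x j - y j\<bar> \<le> 1 / real M" for j
      proof (cases "j < n")
        case True
        have "(real (q j) + 1) / M = real (q j) / M + 1 / M" by (simp add: add_divide_distrib)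
        moreover have "real (q j) / M \<le> x j" "x j \<le> (real (q j) + 1) / M"
            "real (q j) / M \<le> y j" "y j \<le> (real (q j) + 1) / M"
          using xy True by (simp_all add: Cell_def)
        ultimately show ?thesis by linarith
      qed (use xy in \<open>auto simp: Cell_def\<close>)
      then show "dist x y \<le> 2 * (1 / real M) + (1/2) ^ N"
        by (rule dist_fun_le_of_coordinates)
     qed
     then show ?thesis
       by (auto simp: diameter_def intro!: cSUP_least)
    qed
    ultimately show ?thesis
      using \<delta>[of "Cell q"] N M_small \<open>\<delta> > 0\<close> by fastforce
  qed
  \<comment> \<open>The Lebesgue number takes care of the cells in the unit cube, periodicity of all others.\<close>
  have cell: "\<exists>i<n. Cell q \<subseteq> W i" for q
  proof -
    obtain i where i: "i < n" "Cell (\<lambda>j. q j mod M) \<subseteq> W i"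
      using small_cell[of "\<lambda>j. q j mod M"] by (auto simp: M_def)
    have "x \<in> W i" if x: "x \<in> Cell q" for x
    proof -
      define z where "z j = (if j < n then real (q j div M) else 0)" for j
      have "(\<lambda>j. x j - z j) \<in> Cell (\<lambda>j. q j mod M)"
        using x quotient[of "q j" for j] unfolding Cell_def z_def by (auto simp: add_divide_distrib)
      then have "(\<lambda>j. (x j - z j) + z j) \<in> W i"
        using i by (intro W_periodic) (auto simp: z_def)
      then show ?thesis by simp
    qed
    then show ?thesis using i by blast
  qed

  obtain B0 where B0: "\<And>i q. i < n \<Longrightarrow> \<bar>h i (g q)\<bar> \<le> B0"
  proof -
    define Q where "Q = {f :: nat \<Rightarrow> nat. \<forall>j. (j \<in> {..<n} \<longrightarrow> f j \<in> {..<M}) \<and> (j \<notin> {..<n} \<longrightarrow> f j = 0)}"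
    have "finite Q"
      unfolding Q_def by (rule finite_set_of_finite_funs) auto
    then have fin: "finite ((\<lambda>(i, f). \<bar>h i (g f)\<bar>) ` ({..<n} \<times> Q))"
      by simp
    have "\<bar>h i (g q)\<bar> \<le> Max ((\<lambda>(i, f). \<bar>h i (g f)\<bar>) ` ({..<n} \<times> Q))" if "i < n" for i q
    proof -
      define f where "f = (\<lambda>j. if j < n then q j mod M else 0)"
      define z where "z j = (if j < n then real (q j div M) else 0)" for j
      have "g q = (\<lambda>j. g f j + z j)"
        using quotient[of "q j" for j] by (auto simp: g_def f_def z_def)
      then have "h i (g q) = h i (g f)"
        using h_periodic[OF that, of z "g f"] by (simp add: z_def)
      moreover have "f \<in> Q"
        by (auto simp: f_def Q_def M_def)
      ultimately show ?thesis
        using that by (intro Max_ge[OF fin]) auto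
    qed
    then show ?thesis using that by blast
  qed
  define B where "B = Max ((\<lambda>i. \<bar>lam i 0\<bar>) ` {..<n}) + B0"
  have B: "\<bar>lam i 0\<bar> + \<bar>h i (g q)\<bar> \<le> B" if "i < n" for i and q :: "nat \<Rightarrow> nat"
  proof -
    have "\<bar>lam i 0\<bar> \<le> Max ((\<lambda>i. \<bar>lam i 0\<bar>) ` {..<n})"
      using that by (intro Max_ge) auto
    then show ?thesis using B0[OF that, of q] by (simp add: B_def)
  qed
  obtain L0 :: nat where L0: "2 * B < real L0"
    using reals_Archimedean2 by blast
  define p where "p = Suc L0 * M"
  have p_pos: "0 < p" by (simp add: p_def M_def)
  have lam_nat: "lam i (real l) = lam i 0 + real l" if "i < n" for i l
  proof (induction l)
    case (Suc l)
    then show ?case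
      using lam_shift[OF that, of "real l"] by (simp add: add.commute)
  qed simp

  \<comment> \<open>A grid point gets a meaningful \<open>i\<close>th label only next to a cell in \<open>W i\<close>; elsewhere the label just
    has to satisfy the boundary condition of Kuhn's lemma.\<close>
  define near where "near x i \<longleftrightarrow>
     (\<exists>q. Cell q \<subseteq> W i \<and> (\<forall>j<n. q j \<le> x j \<and> x j \<le> q j + 1))" for x :: "nat \<Rightarrow> nat" and i
  define label where "label x i =
     (if near x i then (if lam i (g x i) - h i (g x) > B then 1 else 0)
      else (if x i = p then 1 else 0 :: nat))" for x :: "nat \<Rightarrow> nat" and i
  obtain q where q: "\<forall>i<n. q i < p"
    and rs: "\<forall>i<n. \<exists>r s. (\<forall>j<n. q j \<le> r j \<and> r j \<le> q j + 1) \<and> (\<forall>j<n. q j \<le> s j \<and> s j \<le> q j + 1)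
                 \<and> label r i \<noteq> label s i"
  proof (rule kuhn_lemma[of p n label])
    show "\<forall>x. (\<forall>i<n. x i \<le> p) \<longrightarrow> (\<forall>i<n. label x i = 0 \<or> label x i = 1)"
      by (simp add: label_def)
    show "\<forall>x. (\<forall>i<n. x i \<le> p) \<longrightarrow> (\<forall>i<n. x i = 0 \<longrightarrow> label x i = 0)"
    proof (intro allI impI)
      fix x :: "nat \<Rightarrow> nat" and i assume "i < n" "x i = 0"
      then have "lam i (g x i) - h i (g x) \<le> B"
        using B[of i x] by (simp add: g_def)
      then show "label x i = 0"
        using \<open>x i = 0\<close> p_pos by (simp add: label_def)
    qed
    show "\<forall>x. (\<forall>i<n. x i \<le> p) \<longrightarrow> (\<forall>i<n. x i = p \<longrightarrow> label x i = 1)"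
    proof (intro allI impI)
      fix x :: "nat \<Rightarrow> nat" and i assume "i < n" "x i = p"
      then have "g x i = real (Suc L0)"
        using M_pos by (simp add: g_def p_def field_simps)
      then have "lam i (g x i) = lam i 0 + real (Suc L0)"
        using lam_nat[OF \<open>i < n\<close>, of "Suc L0"] by simp
      then have "lam i (g x i) - h i (g x) > B"
        using B[OF \<open>i < n\<close>, of x] L0 by simp
      then show "label x i = 1"
        using \<open>x i = p\<close> by (simp add: label_def)
    qed
  qed (use p_pos in auto)
  obtain i where i: "i < n" "Cell q \<subseteq> W i"
    using cell by blast
  obtain r s where r: "\<forall>j<n. q j \<le> r j \<and> r j \<le> q j + 1" and s: "\<forall>j<n. q j \<le> s j \<and> s j \<le> q j + 1"
    and ne: "label r i \<noteq> label s i"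
    using rs i(1) by blast
  have in_cell: "g x \<in> Cell q" if x: "\<forall>j<n. q j \<le> x j \<and> x j \<le> q j + 1" for x :: "nat \<Rightarrow> nat"
  proof -
    have "real (x j) \<le> real (q j) + 1" if "j < n" for j
      using x that by (metis of_nat_1 of_nat_add of_nat_mono)
    then show ?thesis
      using x M_pos by (auto simp: Cell_def g_def divide_right_mono)
  qed
  have "lam i (g r i) - h i (g r) = lam i (g s i) - h i (g s)"
  proof (rule segment[OF i(1)])
    fix \<tau> :: real assume \<tau>: "0 \<le> \<tau>" "\<tau> \<le> 1"
    have "(\<lambda>j. (1 - \<tau>) * g r j + \<tau> * g s j) \<in> Cell q"
      unfolding Cell_def mem_Collect_eq
    proof (intro conjI allI impI)
      fix j assume j: "j < n"
      have "convex {real (q j) / M .. (real (q j) + 1) / M}" by simp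
      moreover have "g r j \<in> {real (q j) / M .. (real (q j) + 1) / M}"
         "g s j \<in> {real (q j) / M .. (real (q j) + 1) / M}"
        using in_cell[OF r] in_cell[OF s] j by (auto simp: Cell_def)
      ultimately have "(1 - \<tau>) *\<^sub>R g r j + \<tau> *\<^sub>R g s j \<in> {real (q j) / M .. (real (q j) + 1) / M}"
        using \<tau> by (intro convexD) auto
      then show "real (q j) / M \<le> (1 - \<tau>) * g r j + \<tau> * g s j"
          "(1 - \<tau>) * g r j + \<tau> * g s j \<le> (real (q j) + 1) / M" by auto
    qed (simp add: g_def)
    then show "(\<lambda>j. (1 - \<tau>) * g r j + \<tau> * g s j) \<in> W i"
      using i(2) by blast
  qed
  moreover have "near r i" "near s i"
    using i(2) r s by (auto simp: near_def)
  ultimately show False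
    using ne by (simp add: label_def)
qed

section \<open>Families of paths\<close>

text \<open>Evaluation of paths is continuous in the compact-open topology because \<open>[0,1]\<close> is locally compact.
So a continuous family of paths is a homotopy.\<close>

lemma continuous_map_uncurry_path_space:
  fixes S :: "real \<Rightarrow> real \<Rightarrow> 'a"
  assumes S: "continuous_map (top_of_set A) (path_space Y) S"
  shows "continuous_map (top_of_set (A \<times> {0..1})) Y (\<lambda>(\<tau>, t). S \<tau> t)"
proof -
  have S_cont: "continuous_map (top_of_set {0..1}) Y (S \<tau>)" if "\<tau> \<in> A" for \<tau>
    using continuous_map_funspace[OF S] that
    by (auto simp: path_space_def map_space_def)
  have "\<exists>N. openin (top_of_set (A \<times> {0..1})) N \<and> p \<in> N \<and> (\<forall>x\<in>N. (case x of (\<tau>, t) \<Rightarrow> S \<tau> t) \<in> U)"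
    if p: "p \<in> A \<times> {0..1}" and U: "openin Y U" "(case p of (\<tau>, t) \<Rightarrow> S \<tau> t) \<in> U" for p U
  proof -
    obtain \<tau>0 t0 where p_eq: "p = (\<tau>0, t0)" "\<tau>0 \<in> A" "t0 \<in> {0..1}"
      using p by auto
    have "openin (top_of_set {0..1}) {t \<in> {0..1}. S \<tau>0 t \<in> U}"
      using openin_continuous_map_preimage[OF S_cont[OF p_eq(2)] U(1)] by simp
    then obtain \<epsilon> where \<epsilon>: "\<epsilon> > 0" "\<And>t. t \<in> {0..1} \<Longrightarrow> dist t t0 < \<epsilon> \<Longrightarrow> S \<tau>0 t \<in> U"
      using p_eq U(2) unfolding openin_euclidean_subtopology_iff by auto
    define K where "K = {0..1} \<inter> cball t0 (\<epsilon> / 2)"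
    have "compactin (top_of_set {0..1}) K"
      by (simp add: K_def compactin_subtopology compact_Int)
    then have "openin (path_space Y) {f \<in> map_space (top_of_set {0..1}) Y. f ` K \<subseteq> U}"
      unfolding path_space_def compact_open_topology_def
      using U(1) by (intro topology_generated_by_Basis) blast
    from openin_continuous_map_preimage[OF S this]
    have "openin (top_of_set A) {\<tau> \<in> A. S \<tau> \<in> map_space (top_of_set {0..1}) Y \<and> S \<tau> ` K \<subseteq> U}"
      by simp
    moreover have "{\<tau> \<in> A. S \<tau> \<in> map_space (top_of_set {0..1}) Y \<and> S \<tau> ` K \<subseteq> U} = {\<tau> \<in> A. S \<tau> ` K \<subseteq> U}"
      using continuous_map_funspace[OF S] by (auto simp: path_space_def)
    ultimately have "openin (top_of_set A) {\<tau> \<in> A. S \<tau> ` K \<subseteq> U}" by simp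
    moreover have "openin (top_of_set {0..1}) ({0..1} \<inter> ball t0 (\<epsilon> / 2))"
      by (simp add: openin_open_Int)
    ultimately have "openin (top_of_set (A \<times> {0..1})) ({\<tau> \<in> A. S \<tau> ` K \<subseteq> U} \<times> ({0..1} \<inter> ball t0 (\<epsilon> / 2)))"
      by (rule openin_Times)
    moreover have "p \<in> {\<tau> \<in> A. S \<tau> ` K \<subseteq> U} \<times> ({0..1} \<inter> ball t0 (\<epsilon> / 2))"
      using p_eq \<epsilon> by (auto simp: K_def dist_commute)
    ultimately show ?thesis
      by (intro exI[of _ "{\<tau> \<in> A. S \<tau> ` K \<subseteq> U} \<times> ({0..1} \<inter> ball t0 (\<epsilon> / 2))"])
        (auto simp: K_def image_subset_iff)
  qed
  moreover have "(\<lambda>(\<tau>, t). S \<tau> t) \<in> A \<times> {0..1} \<rightarrow> topspace Y"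
    using continuous_map_funspace[OF S_cont] by auto
  ultimately show ?thesis
    unfolding continuous_map_eq_topcontinuous_at topcontinuous_at_def
    by (simp only: topspace_euclidean_subtopology) blast
qed

section \<open>Logarithms of loops and paths\<close>

lemma constant_on_connected_if_exp_constant:
  fixes f :: "'b::topological_space \<Rightarrow> complex"
  assumes "connected S" and f: "continuous_on S f"
    and one: "\<And>x. x \<in> S \<Longrightarrow> exp (f x) = c"
    and xy: "x \<in> S" "y \<in> S"
  shows "f x = f y"
proof -
  have diff: "(f z - f x) / (2 * pi * \<i>) \<in> \<int>" if "z \<in> S" for z
  proof -
    have "exp (f z) = exp (f x)" using one that xy(1) by simp
    then obtain n :: int where "f z = f x + (of_int (2 * n) * pi) * \<i>"
      unfolding exp_eq by blast
    then have "(f z - f x) / (2 * pi * \<i>) = of_int n" by simp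
    then show ?thesis by simp
  qed
  define d where "d z = Re ((f z - f x) / (2 * pi * \<i>))" for z
  have int: "d z \<in> \<int>" "complex_of_real (d z) = (f z - f x) / (2 * pi * \<i>)" if z: "z \<in> S" for z
    using diff[OF z] by (auto simp: d_def elim!: Ints_cases)
  have "continuous_on S d"
    unfolding d_def by (intro continuous_intros f) auto
  have "d constant_on S"
  proof (rule continuous_discrete_range_constant[OF \<open>connected S\<close> \<open>continuous_on S d\<close>])
    fix z assume z: "z \<in> S"
    have "1 \<le> norm (d w - d z)" if "w \<in> S" "d w \<noteq> d z" for w
    proof -
      have "d w - d z \<in> \<int>" using int(1) that(1) z by simp
      then show ?thesis using Ints_nonzero_abs_ge1[of "d w - d z"] that(2) by simp
    qed
    then show "\<exists>e>0. \<forall>w. w \<in> S \<and> d w \<noteq> d z \<longrightarrow> e \<le> norm (d w - d z)"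
      by (intro exI[of _ 1]) auto
  qed
  then have "d y = d x" using xy by (auto simp: constant_on_def)
  then have "(f y - f x) / (2 * pi * \<i>) = (f x - f x) / (2 * pi * \<i>)"
    using int(2)[OF xy(1)] int(2)[OF xy(2)] by simp
  then show ?thesis by simp
qed

text \<open>A loop in \<open>\<complex> - {0}\<close> that is negated by a half turn has odd winding number: the logarithm grows by the
same odd multiple of \<open>\<pi>\<i>\<close> over each half of the period. In this way the winding number of two
particles around each other is seen to be nonzero without any knowledge of how their tripod sits in the
plane.\<close>

lemma log_of_antiperiodic_loop:
  fixes a :: "real \<Rightarrow> complex"
  assumes a: "continuous_on UNIV a" and nz: "\<And>t. a t \<noteq> 0" and anti: "\<And>t. a (t + 1/2) = - a t"
  obtains l and d :: int where "continuous_on UNIV l" "\<And>t. exp (l t) = a t"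
    "\<And>t. l (t + 1) = l t + 2 * pi * of_int d * \<i>" "d \<noteq> 0"
proof -
  obtain l where l: "continuous_on UNIV l" "\<And>t. a t = exp (l t)"
    using continuous_logarithm_on_contractible[OF a] nz by (metis UNIV_I contractible_UNIV)
  have "exp (l (t + 1/2) - l t) = -1" for t
    using nz[of t] anti[of t] l(2) by (simp add: exp_diff)
  moreover have "continuous_on UNIV (\<lambda>t. l (t + 1/2) - l t)"
    by (intro continuous_intros continuous_on_compose2[OF l(1)]) auto
  ultimately have const: "l (t + 1/2) - l t = l (0 + 1/2) - l 0" for t
    by (intro constant_on_connected_if_exp_constant[where S = UNIV and f = "\<lambda>t. l (t + 1/2) - l t" and c = "-1"]) auto
  have "exp (l (0 + 1/2) - l 0) = exp (\<i> * pi)"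
    using \<open>\<And>t. exp (l (t + 1/2) - l t) = -1\<close>[of 0] by simp
  then obtain n :: int where n: "l (0 + 1/2) - l 0 = \<i> * pi + (of_int (2 * n) * pi) * \<i>"
    unfolding exp_eq by blast
  have "l (t + 1) = l t + 2 * pi * of_int (2 * n + 1) * \<i>" for t
  proof -
    have "l (t + 1) = l (t + 1/2 + 1/2)" by (simp add: add.assoc)
    also have "\<dots> = l t + 2 * (\<i> * pi + (of_int (2 * n) * pi) * \<i>)"
      using const[of t] const[of "t + 1/2"] unfolding n by (simp only: diff_eq_eq) simp
    finally show ?thesis
      by (simp add: algebra_simps)
  qed
  moreover have "2 * n + 1 \<noteq> 0" by presburger
  ultimately show ?thesis using that l by metis
qed

text \<open>The amount \<open>L t - L t'\<close> by which a continuous logarithm \<open>L\<close> of the path \<open>p\<close> changes does not depend on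
the choice of \<open>L\<close>. It is defined for each single path, so that for a path that depends on a point of the
torus it is automatically a function on the torus, not only on its universal cover.\<close>

definition log_change :: "(real \<Rightarrow> complex) \<Rightarrow> real \<Rightarrow> real \<Rightarrow> complex" where
  "log_change p t t' = (let L = (SOME L. continuous_on {0..1} L \<and> (\<forall>t\<in>{0..1}. exp (L t) = p t)) in L t - L t')"

lemma log_change_eq:
  assumes L: "continuous_on {0..1} L" "\<And>t. t \<in> {0..1} \<Longrightarrow> exp (L t) = p t"
    and t: "t \<in> {0..1}" "t' \<in> {0..1}"
  shows "log_change p t t' = L t - L t'"
proof -
  define L' where "L' = (SOME L. continuous_on {0..1} L \<and> (\<forall>t\<in>{0..1}. exp (L t) = p t))"
  have L': "continuous_on {0..1} L' \<and> (\<forall>t\<in>{0..1}. exp (L' t) = p t)"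
    unfolding L'_def by (rule someI[of _ L]) (use L in auto)
  have "exp (L x - L' x) = 1" if "x \<in> {0..1}" for x
    using L(2)[OF that] L' that exp_not_eq_zero[of "L x"] by (simp add: exp_diff)
  moreover have "continuous_on {0..1} (\<lambda>t. L t - L' t)"
    using L(1) L' by (intro continuous_intros) auto
  ultimately have "L t - L' t = L t' - L' t'"
    using t by (intro constant_on_connected_if_exp_constant[of "{0..1::real}" "\<lambda>t. L t - L' t" 1]) auto
  then show ?thesis
    unfolding log_change_def L'_def[symmetric] Let_def by (simp add: algebra_simps)
qed

lemma continuous_on_log_change:
  fixes S :: "real \<Rightarrow> real \<Rightarrow> 'a"
  assumes S: "continuous_map (top_of_set {0..1}) (path_space Y) S"
    and g: "continuous_map Y euclidean g" and nz: "\<And>y. y \<in> topspace Y \<Longrightarrow> g y \<noteq> 0"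
    and t: "t \<in> {0..1}" "t' \<in> {0..1}"
  shows "continuous_on {0..1} (\<lambda>\<tau>. log_change (\<lambda>t. g (S \<tau> t)) t t')"
    and "\<tau> \<in> {0..1} \<Longrightarrow> exp (log_change (\<lambda>t. g (S \<tau> t)) t t') = g (S \<tau> t) / g (S \<tau> t')"
proof -
  have SY: "continuous_map (top_of_set ({0..1} \<times> {0..1})) Y (\<lambda>(\<tau>, t). S \<tau> t)"
    by (rule continuous_map_uncurry_path_space[OF S])
  have gS: "continuous_on ({0..1} \<times> {0..1}) (\<lambda>p. g (case p of (\<tau>, t) \<Rightarrow> S \<tau> t))"
    using continuous_map_compose[OF SY g] by (simp add: o_def)
  have nz': "g (case p of (\<tau>, t) \<Rightarrow> S \<tau> t) \<noteq> 0" if "p \<in> {0..1} \<times> {0..1}" for p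
    using funcset_mem[OF continuous_map_funspace[OF SY], of p] that nz by simp
  have "contractible ({0..1::real} \<times> {0..1::real})"
    by (intro convex_imp_contractible convex_Times) auto
  then obtain L where L: "continuous_on ({0..1} \<times> {0..1}) L"
    "\<And>p. p \<in> {0..1} \<times> {0..1} \<Longrightarrow> g (case p of (\<tau>, t) \<Rightarrow> S \<tau> t) = exp (L p)"
    using continuous_logarithm_on_contractible[OF gS _ nz'] by metis
  have eq: "log_change (\<lambda>t. g (S \<tau> t)) t t' = L (\<tau>, t) - L (\<tau>, t')" if "\<tau> \<in> {0..1}" for \<tau>
  proof (rule log_change_eq[OF _ _ t])
    show "continuous_on {0..1} (\<lambda>t. L (\<tau>, t))"
      using that by (intro continuous_on_compose2[OF L(1)] continuous_intros) auto
    show "exp (L (\<tau>, t)) = g (S \<tau> t)" if "t \<in> {0..1}" for t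
      using L(2)[of "(\<tau>, t)"] that \<open>\<tau> \<in> {0..1}\<close> by simp
  qed
  have "continuous_on {0..1} (\<lambda>\<tau>. L (\<tau>, t) - L (\<tau>, t'))"
    using t by (intro continuous_intros continuous_on_compose2[OF L(1)]) auto
  then show "continuous_on {0..1} (\<lambda>\<tau>. log_change (\<lambda>t. g (S \<tau> t)) t t')"
    by (rule continuous_on_eq) (simp add: eq)
  show "exp (log_change (\<lambda>t. g (S \<tau> t)) t t') = g (S \<tau> t) / g (S \<tau> t')" if "\<tau> \<in> {0..1}"
    using eq[OF that] L(2)[of "(\<tau>, t)"] L(2)[of "(\<tau>, t')"] that t by (simp add: exp_diff)
qed

section \<open>A lower bound for topological complexity\<close>

text \<open>An open cover with at most \<open>n\<close> members can be listed as \<open>U 0, \<dots>, U (n - 1)\<close>, with repetitions.\<close>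

lemma TC_geI:
  assumes "topspace (power_topology r Y) \<noteq> {}"
    and "\<And>U. \<lbrakk>\<And>x. x \<in> topspace (power_topology r Y) \<Longrightarrow> \<exists>i<n. x \<in> U i;
          \<And>i. i < n \<Longrightarrow> openin (power_topology r Y) (U i); \<And>i. i < n \<Longrightarrow> has_local_section r Y (U i)\<rbrakk> \<Longrightarrow> False"
  shows "enat n \<le> TC r Y"
proof -
  have many: "enat (Suc n) \<le> enat (card \<U>)"
    if fin: "finite \<U>" and cov: "\<Union>\<U> = topspace (power_topology r Y)"
      and sec: "\<And>U. U \<in> \<U> \<Longrightarrow> openin (power_topology r Y) U \<and> has_local_section r Y U" for \<U>
  proof (rule ccontr)
    assume "\<not> ?thesis"
    then have le: "card \<U> \<le> n" by simp
    have "\<U> \<noteq> {}" using assms(1) unfolding cov[symmetric] by blast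
    then have pos: "0 < card \<U>" using fin by (simp add: card_gt_0_iff)
    obtain f where f: "bij_betw f {0..<card \<U>} \<U>"
      using ex_bij_betw_nat_finite[OF fin] by blast
    define U where "U i = f (if i < card \<U> then i else 0)" for i
    have f_image: "f ` {0..<card \<U>} = \<U>"
      using f by (simp add: bij_betw_def)
    have U_in: "U i \<in> \<U>" for i
      using f_image pos imageI[of "if i < card \<U> then i else 0" "{0..<card \<U>}" f] by (simp add: U_def)
    show False
    proof (rule assms(2)[of U])
      fix x assume "x \<in> topspace (power_topology r Y)"
      then obtain A where "A \<in> \<U>" "x \<in> A" using cov by blast
      then have "A \<in> f ` {0..<card \<U>}" using f_image by simp
      then obtain i where "i < card \<U>" "x \<in> f i" using \<open>x \<in> A\<close> by auto
      then show "\<exists>i<n. x \<in> U i"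
        using le by (intro exI[of _ i]) (simp add: U_def)
    qed (use sec[OF U_in] in blast)+
  qed
  have "enat (Suc n) \<le> Inf {enat (card \<U>) | \<U>. finite \<U> \<and> \<Union>\<U> = topspace (power_topology r Y) \<and>
            (\<forall>U\<in>\<U>. openin (power_topology r Y) U \<and> has_local_section r Y U)}"
  proof (rule Inf_greatest, elim CollectE exE conjE)
    fix c \<U>
    assume "c = enat (card \<U>)" "finite \<U>" "\<Union>\<U> = topspace (power_topology r Y)"
      and "\<forall>U\<in>\<U>. openin (power_topology r Y) U \<and> has_local_section r Y U"
    then show "enat (Suc n) \<le> c"
      using many[of \<U>] by (simp only: Ball_def)
  qed
  moreover have "enat n \<le> c - 1" if "enat (Suc n) \<le> c" for c
    using that by (cases c) (auto simp: one_enat_def)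
  ultimately show ?thesis
    unfolding TC_def by blast
qed

text \<open>The zero-divisor cup-length bound for \<open>TC\<close>, for zero-divisors that are pulled back from the circle and
detected on a torus \<open>\<Phi>\<close>. Each \<open>g i\<close> stands for the class in \<open>H\<^sup>1(Y)\<close> that it pulls back from \<open>\<complex> - {0}\<close>, and
the zero-divisor is the difference of its pullbacks under the projections \<open>a i\<close> and \<open>b i\<close> of \<open>Y\<^sup>r\<close>. On
the torus the first pullback is \<open>d i \<noteq> 0\<close> times the \<open>i\<close>th coordinate class (the logarithm \<open>l i\<close> depends
on that coordinate only and gains \<open>d i\<close> full turns per period), and the second one is zero (\<open>\<rho> i\<close> is a periodic logarithm).
So the product of the \<open>n\<close> zero-divisors is a nonzero multiple of the fundamental class.

In place of cup products: a section over \<open>U\<close> connects the projections \<open>a i\<close> and \<open>b i\<close> by a homotopy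
over \<open>U\<close>. The change of the logarithm of \<open>g i\<close> along the paths of the section, added to \<open>\<rho> i\<close>, is then
a lift of \<open>l i\<close> over the preimage of \<open>U\<close> in the torus, up to locally constant terms. Since this works for any
\<open>U\<close> and \<open>i\<close>, a cover by \<open>n\<close> sets with sections would contradict the obstruction for the torus.\<close>

lemma TC_lower_bound_from_torus:
  fixes Y :: "'b topology" and \<Phi> :: "(nat \<Rightarrow> real) \<Rightarrow> nat \<Rightarrow> 'b"
    and g :: "nat \<Rightarrow> 'b \<Rightarrow> complex" and l :: "nat \<Rightarrow> real \<Rightarrow> complex"
    and \<rho> :: "nat \<Rightarrow> (nat \<Rightarrow> real) \<Rightarrow> complex" and d :: "nat \<Rightarrow> int"
  assumes r: "r \<ge> 2"
    and \<Phi>: "continuous_map euclidean (power_topology r Y) \<Phi>"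
    and \<Phi>_periodic: "\<And>x z. (\<And>j. z j \<in> \<int>) \<Longrightarrow> \<Phi> (\<lambda>j. x j + z j) = \<Phi> x"
    and g: "\<And>i. i < n \<Longrightarrow> continuous_map Y euclidean (g i)"
      "\<And>i y. \<lbrakk>i < n; y \<in> topspace Y\<rbrakk> \<Longrightarrow> g i y \<noteq> 0"
    and factors: "\<And>i. i < n \<Longrightarrow> a i < r \<and> b i < r"
    and l: "\<And>i. i < n \<Longrightarrow> continuous_on UNIV (l i)"
      "\<And>i x. i < n \<Longrightarrow> exp (l i (x i)) = g i (\<Phi> x (a i))"
      "\<And>i t. i < n \<Longrightarrow> l i (t + 1) = l i t + 2 * pi * of_int (d i) * \<i>"
    and d: "\<And>i. i < n \<Longrightarrow> d i \<noteq> 0"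
    and \<rho>: "\<And>i. i < n \<Longrightarrow> continuous_on UNIV (\<rho> i)"
      "\<And>i x. i < n \<Longrightarrow> exp (\<rho> i x) = g i (\<Phi> x (b i))"
      "\<And>i x z. \<lbrakk>i < n; \<And>j. z j \<in> \<int>\<rbrakk> \<Longrightarrow> \<rho> i (\<lambda>j. x j + z j) = \<rho> i x"
  shows "enat n \<le> TC r Y"
proof (rule TC_geI)
  have \<Phi>_in: "\<Phi> x \<in> topspace (power_topology r Y)" for x
    using continuous_map_funspace[OF \<Phi>] by auto
  then show "topspace (power_topology r Y) \<noteq> {}" by blast
  fix U assume cover: "\<And>x. x \<in> topspace (power_topology r Y) \<Longrightarrow> \<exists>i<n. x \<in> U i"
    and U_open: "\<And>i. i < n \<Longrightarrow> openin (power_topology r Y) (U i)"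
    and "\<And>i. i < n \<Longrightarrow> has_local_section r Y (U i)"
  then obtain s where s: "\<And>i. i < n \<Longrightarrow> continuous_map (subtopology (power_topology r Y) (U i)) (path_space Y) (s i)"
    "\<And>i x. \<lbrakk>i < n; x \<in> U i\<rbrakk> \<Longrightarrow> path_eval r (s i x) = x"
    unfolding has_local_section_def by metis
  define T where "T j = real j / (real r - 1)" for j
  have T: "T j \<in> {0..1}" if "j < r" for j
    using that r by (auto simp: T_def field_simps)
  have T_eval: "s i x (T j) = x j" if "i < n" "x \<in> U i" "j < r" for i x j
    using fun_cong[OF s(2)[OF that(1,2)], of j] that(3) by (simp add: path_eval_def T_def)
  define chg where "chg i x = log_change (\<lambda>t. g i (s i (\<Phi> x) t)) (T (a i)) (T (b i))" for i x
  show False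
  proof (rule torus_cover_obstruction[of n "\<lambda>i. {x. \<Phi> x \<in> U i}" "\<lambda>i x. Im (\<rho> i x + chg i x) / (2 * pi * d i)"
        "\<lambda>i t. Im (l i t) / (2 * pi * d i)"])
    show "open {x. \<Phi> x \<in> U i}" if "i < n" for i
      using openin_continuous_map_preimage[OF \<Phi> U_open[OF that]] by simp
    show "\<exists>i<n. x \<in> {x. \<Phi> x \<in> U i}" for x
      using cover[OF \<Phi>_in] by simp
    show "(\<lambda>j. x j + z j) \<in> {x. \<Phi> x \<in> U i}" if "i < n" "x \<in> {x. \<Phi> x \<in> U i}" "\<And>j. z j \<in> \<int>" for i x z
      using that \<Phi>_periodic[of z x] by simp
    show "Im (\<rho> i (\<lambda>j. x j + z j) + chg i (\<lambda>j. x j + z j)) / (2 * pi * d i) = Im (\<rho> i x + chg i x) / (2 * pi * d i)"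
      if "i < n" "\<And>j. z j \<in> \<int>" for i x z
      using \<Phi>_periodic[of z x] \<rho>(3)[OF that(1), of z x] that(2) by (simp add: chg_def)
    show "Im (l i (t + 1)) / (2 * pi * d i) = Im (l i t) / (2 * pi * d i) + 1" if "i < n" for i t
    proof -
      have "Im (l i (t + 1)) = Im (l i t) + 2 * pi * d i"
        by (subst l(3)[OF that]) simp
      then show ?thesis using d[OF that] by (simp add: add_divide_distrib)
    qed
  next
    fix i x y
    assume i: "i < n" and seg: "\<And>\<tau>. \<lbrakk>0 \<le> \<tau>; \<tau> \<le> 1\<rbrakk> \<Longrightarrow> (\<lambda>j. (1 - \<tau>) * x j + \<tau> * y j) \<in> {x. \<Phi> x \<in> U i}"
    define \<sigma> where "\<sigma> \<tau> = (\<lambda>j. (1 - \<tau>) * x j + \<tau> * y j)" for \<tau>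
    have \<sigma>: "continuous_on {0..1} \<sigma>"
      unfolding \<sigma>_def by (intro continuous_intros)
    have in_U: "\<Phi> (\<sigma> \<tau>) \<in> U i" if "\<tau> \<in> {0..1}" for \<tau>
      using seg[of \<tau>] that by (simp add: \<sigma>_def)
    have "continuous_map (top_of_set {0..1}) (power_topology r Y) (\<Phi> \<circ> \<sigma>)"
      using \<sigma> by (intro continuous_map_compose[OF _ \<Phi>]) simp
    then have "continuous_map (top_of_set {0..1}) (subtopology (power_topology r Y) (U i)) (\<Phi> \<circ> \<sigma>)"
      using in_U by (auto simp: continuous_map_in_subtopology)
    then have S: "continuous_map (top_of_set {0..1}) (path_space Y) (\<lambda>\<tau>. s i (\<Phi> (\<sigma> \<tau>)))"
      using continuous_map_compose[OF _ s(1)[OF i]] by (fastforce simp: o_def)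
    note chg = continuous_on_log_change[OF S g(1)[OF i] g(2)[OF i] T T]
    \<comment> \<open>Both terms compare the same two values of \<open>g i\<close>, so their difference is a multiple of \<open>2\<pi>\<i>\<close>.\<close>
    define F where "F \<tau> = l i (\<sigma> \<tau> i) - \<rho> i (\<sigma> \<tau>) - chg i (\<sigma> \<tau>)" for \<tau>
    have "continuous_on {0..1} (\<lambda>\<tau>. chg i (\<sigma> \<tau>))"
      unfolding chg_def using chg(1) factors[OF i] by blast
    moreover have "continuous_on {0..1} (\<lambda>\<tau>. l i (\<sigma> \<tau> i))"
      by (intro continuous_on_compose2[OF l(1)[OF i]] continuous_on_product_then_coordinatewise[OF \<sigma>]) auto
    moreover have "continuous_on {0..1} (\<lambda>\<tau>. \<rho> i (\<sigma> \<tau>))"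
      by (intro continuous_on_compose2[OF \<rho>(1)[OF i]] \<sigma>) auto
    ultimately have "continuous_on {0..1} F"
      unfolding F_def by (intro continuous_intros)
    moreover have "exp (F \<tau>) = 1" if \<tau>: "\<tau> \<in> {0..1}" for \<tau>
    proof -
      have "exp (chg i (\<sigma> \<tau>)) = g i (\<Phi> (\<sigma> \<tau>) (a i)) / g i (\<Phi> (\<sigma> \<tau>) (b i))"
        unfolding chg_def using chg(2)[OF _ _ _ \<tau>] factors[OF i] T_eval[OF i in_U[OF \<tau>]] by simp
      moreover have "\<Phi> (\<sigma> \<tau>) j \<in> topspace Y" if "j < r" for j
        using \<Phi>_in[of "\<sigma> \<tau>"] that by (auto simp: power_topology_def)
      ultimately show ?thesis
        using factors[OF i] g(2)[OF i] by (simp add: F_def exp_diff l(2)[OF i] \<rho>(2)[OF i])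
    qed
    ultimately have "F 0 = F 1"
      by (intro constant_on_connected_if_exp_constant[of "{0..1}" F 1]) auto
    then have "Im (l i (x i)) - Im (\<rho> i x + chg i x) = Im (l i (y i)) - Im (\<rho> i y + chg i y)"
      by (simp add: F_def \<sigma>_def complex_eq_iff)
    then show "Im (l i (x i)) / (2 * pi * d i) - Im (\<rho> i x + chg i x) / (2 * pi * d i)
             = Im (l i (y i)) / (2 * pi * d i) - Im (\<rho> i y + chg i y) / (2 * pi * d i)"
      by (simp only: diff_divide_distrib[symmetric])
  qed
qed

section \<open>Tripods at the essential vertices\<close>

text \<open>For \<open>j < 3\<close>, \<open>prong j z\<close> is \<open>Re (z * cnj (\<omega> ^ j)) - 1/2\<close> with \<open>\<omega> = cis (2 * pi / 3)\<close>. Its positive part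
is the height on the \<open>j\<close>th leg of the point to which \<open>z\<close> is sent by a map from the unit disk to a tripod.
With the offset \<open>1/2\<close>, the three caps of the disk on which \<open>prong j\<close> is positive are just disjoint, and on the circle
they leave only the points \<open>- \<omega> ^ j\<close> uncovered, whose antipodes are inside the caps.\<close>

definition prong :: "nat \<Rightarrow> complex \<Rightarrow> real" where
  "prong j z = (if j = 0 then Re z else if j = 1 then (sqrt 3 * Im z - Re z) / 2
                else (- sqrt 3 * Im z - Re z) / 2) - 1/2"

lemma prong_bounds:
  assumes "cmod z \<le> 1"
  shows "-3/2 \<le> prong j z \<and> prong j z \<le> 1/2"
proof -
  define x y where "x = Re z" and "y = Im z"
  have xy: "x\<^sup>2 + y\<^sup>2 \<le> 1"
    using assms by (simp add: x_def y_def cmod_def)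
  have bound: "-1 \<le> u \<and> u \<le> 1" if "u\<^sup>2 \<le> 1" for u :: real
    using that by (simp add: abs_square_le_1 abs_le_iff)
  have "((sqrt 3 * y - x) / 2)\<^sup>2 + ((sqrt 3 * x + y) / 2)\<^sup>2 = x\<^sup>2 + y\<^sup>2"
    "((- sqrt 3 * y - x) / 2)\<^sup>2 + ((sqrt 3 * x - y) / 2)\<^sup>2 = x\<^sup>2 + y\<^sup>2"
    by (simp_all add: power2_eq_square field_simps)
  then have "((sqrt 3 * y - x) / 2)\<^sup>2 \<le> 1" "((- sqrt 3 * y - x) / 2)\<^sup>2 \<le> 1"
    using xy zero_le_power2[of "(sqrt 3 * x + y) / 2"] zero_le_power2[of "(sqrt 3 * x - y) / 2"] by linarith+
  moreover have "x\<^sup>2 \<le> 1" using xy zero_le_power2[of y] by linarith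
  ultimately have range: "-1 \<le> x \<and> x \<le> 1" "-1 \<le> (sqrt 3 * y - x) / 2 \<and> (sqrt 3 * y - x) / 2 \<le> 1"
    "-1 \<le> (- sqrt 3 * y - x) / 2 \<and> (- sqrt 3 * y - x) / 2 \<le> 1"
    using bound by blast+
  have shift: "-3/2 \<le> u - 1/2 \<and> u - 1/2 \<le> 1/2" if "-1 \<le> u \<and> u \<le> 1" for u :: real
    using that by auto
  show ?thesis
    unfolding prong_def using range[THEN shift, unfolded x_def y_def] by presburger
qed

text \<open>The caps of two legs do not overlap: since the cube roots of unity add up to zero, the sum of two
prongs is determined by the third one, which is at least \<open>-3/2\<close>.\<close>

lemma prong_sum:
  assumes "cmod z \<le> 1" "i < 3" "j < 3" "i \<noteq> j"
  shows "prong i z + prong j z \<le> 0"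
proof -
  have "prong 0 z + prong 1 z + prong 2 z = - 3/2"
    by (simp add: prong_def field_simps)
  moreover have "-3/2 \<le> prong 0 z" "-3/2 \<le> prong 1 z" "-3/2 \<le> prong 2 z"
    using prong_bounds[OF assms(1)] by blast+
  moreover have "i = 0 \<or> i = 1 \<or> i = 2" "j = 0 \<or> j = 1 \<or> j = 2"
    using assms by auto
  ultimately show ?thesis
    using assms(4) by auto
qed

lemma prong_uminus: "prong j (- z) = - 1 - prong j z"
  by (simp add: prong_def field_simps)

text \<open>The squares of the three numbers \<open>Re (z * cnj (\<omega> ^ j))\<close> add up to \<open>3/2\<close> on the circle, so one of
these numbers exceeds \<open>1/2\<close> in absolute value.\<close>

lemma prong_antipodal:
  assumes "cmod z = 1"
  shows "\<exists>j<3. prong j z > 0 \<or> prong j (- z) > 0"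
proof (rule ccontr)
  assume "\<not> ?thesis"
  then have "prong j z \<le> 0 \<and> prong j z \<ge> -1" if "j < 3" for j
    using prong_uminus[of j z] that by force
  then have *: "\<bar>prong j z + 1/2\<bar> \<le> 1/2" if "j < 3" for j
    unfolding abs_le_iff using that by fastforce
  define x y where "x = Re z" and "y = Im z"
  have "x\<^sup>2 + y\<^sup>2 = 1"
    using assms by (simp add: x_def y_def cmod_def)
  have sq: "u\<^sup>2 \<le> 1/4" if "\<bar>u\<bar> \<le> 1/2" for u :: real
    using power_mono[OF that, of 2] by (simp add: power2_eq_square)
  have "\<bar>x\<bar> \<le> 1/2" "\<bar>(sqrt 3 * y - x) / 2\<bar> \<le> 1/2" "\<bar>(- sqrt 3 * y - x) / 2\<bar> \<le> 1/2"
    using *[of 0] *[of 1] *[of 2] by (simp_all add: prong_def x_def y_def)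
  then have "x\<^sup>2 \<le> 1/4" "((sqrt 3 * y - x) / 2)\<^sup>2 \<le> 1/4" "((- sqrt 3 * y - x) / 2)\<^sup>2 \<le> 1/4"
    using sq by blast+
  then have "x\<^sup>2 + ((sqrt 3 * y - x) / 2)\<^sup>2 + ((- sqrt 3 * y - x) / 2)\<^sup>2 \<le> 1/4 + 1/4 + 1/4"
    by (intro add_mono)
  moreover have "x\<^sup>2 + ((sqrt 3 * y - x) / 2)\<^sup>2 + ((- sqrt 3 * y - x) / 2)\<^sup>2 = 3/2 * (x\<^sup>2 + y\<^sup>2)"
    by (simp add: power2_eq_square field_simps)
  ultimately have "3/2 * (x\<^sup>2 + y\<^sup>2) \<le> 1/4 + 1/4 + 1/4" by metis
  then show False unfolding \<open>x\<^sup>2 + y\<^sup>2 = 1\<close> by simp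
qed

text \<open>As \<open>z\<close> runs once around the circle, \<open>\<psi> z\<close> and \<open>\<psi> (- z)\<close> perform the classical motion of two
particles on a tripod that avoid each other by making way on the free leg, and that are exchanged
after each half turn. It is convenient that the motion of a single particle extends to the disk:
the disk is convex, which replaces the contractibility of the tripod in all that follows.\<close>

lemma disk_to_tripod:
  assumes legs: "\<And>j. j < 3 \<Longrightarrow> continuous_map (top_of_set {0..1/2}) X (L j)"
    and centre: "\<And>j. j < (3::nat) \<Longrightarrow> L j (0::real) = v"
    and off_centre: "\<And>j s. \<lbrakk>j < 3; 0 < s; s \<le> 1/2\<rbrakk> \<Longrightarrow> L j s \<noteq> v"
    and disjoint: "\<And>i j s t. \<lbrakk>i < 3; j < 3; 0 < s; s \<le> 1/2; 0 < t; t \<le> 1/2; L i s = L j t\<rbrakk> \<Longrightarrow> i = j"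
  obtains \<psi> where "continuous_map (top_of_set (cball 0 1)) X \<psi>"
    "\<And>z. cmod z = 1 \<Longrightarrow> \<psi> z \<noteq> \<psi> (- z)"
    "\<And>z. cmod z \<le> 1 \<Longrightarrow> \<psi> z = v \<or> (\<exists>j s. j < 3 \<and> 0 < s \<and> s \<le> 1/2 \<and> \<psi> z = L j s)"
proof -
  define \<psi> where "\<psi> z = (if prong 0 z \<le> 0 then if prong 1 z \<le> 0 then L 2 (max 0 (prong 2 z))
      else L 1 (max 0 (prong 1 z)) else L 0 (max 0 (prong 0 z)))" for z
  have on_leg: "\<psi> z = L j (prong j z)" if z: "cmod z \<le> 1" "j < 3" "prong j z > 0" for j z
  proof -
    have "prong i z < 0" if "i < 3" "i \<noteq> j" for i
      using prong_sum[OF z(1) that(1) z(2) that(2)] z(3) by linarith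
    moreover have "j = 0 \<or> j = 1 \<or> j = 2" using z(2) by auto
    ultimately show ?thesis
      using z(3) unfolding \<psi>_def by (auto simp: less_imp_le max_def)
  qed
  have at_centre: "\<psi> z = v" if "\<And>j. j < 3 \<Longrightarrow> prong j z \<le> 0" for z
    using that[of 0] that[of 1] that[of 2] centre by (simp add: \<psi>_def max_def)
  have cont_prong: "continuous_on S (prong j)" for S j
    unfolding prong_def by (cases "j = 0"; cases "j = 1") (auto intro!: continuous_intros)
  have leg: "continuous_map (top_of_set S) X (\<lambda>z. L j (max 0 (prong j z)))"
    if "S \<subseteq> cball 0 1" "j < 3" for S j
  proof (rule continuous_map_compose[OF _ legs[OF that(2)], unfolded o_def])
    have "max 0 (prong j z) \<in> {0..1/2}" if "z \<in> S" for z
      using prong_bounds[of z j] that \<open>S \<subseteq> cball 0 1\<close> by (auto simp: max_def subset_iff)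
    then show "continuous_map (top_of_set S) (top_of_set {0..1/2}) (\<lambda>z. max 0 (prong j z))"
      by (auto intro!: continuous_intros cont_prong)
  qed
  have inner: "continuous_map (top_of_set S) X
      (\<lambda>z. if prong 1 z \<le> 0 then L 2 (max 0 (prong 2 z)) else L 1 (max 0 (prong 1 z)))"
    if S: "S \<subseteq> cball 0 1" for S
  proof (rule continuous_map_cases_le)
    fix z assume z: "z \<in> topspace (top_of_set S)" "prong 1 z = 0"
    then have "prong 2 z \<le> 0"
      using prong_sum[of z 1 2] S by auto
    then show "L 2 (max 0 (prong 2 z)) = L 1 (max 0 (prong 1 z))"
      using z(2) centre by (simp add: max_def)
  next
    show "continuous_map (subtopology (top_of_set S) {z \<in> topspace (top_of_set S). prong 1 z \<le> 0}) X
        (\<lambda>z. L 2 (max 0 (prong 2 z)))"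
      "continuous_map (subtopology (top_of_set S) {z \<in> topspace (top_of_set S). 0 \<le> prong 1 z}) X
        (\<lambda>z. L 1 (max 0 (prong 1 z)))"
      using S by (auto simp: subtopology_subtopology intro!: leg)
  qed (auto intro!: cont_prong)
  have "continuous_map (top_of_set (cball 0 1)) X \<psi>"
    unfolding \<psi>_def
  proof (rule continuous_map_cases_le)
    fix z assume z: "z \<in> topspace (top_of_set (cball 0 1))" "prong 0 z = 0"
    then have "prong 1 z \<le> 0" "prong 2 z \<le> 0"
      using prong_sum[of z 0 1] prong_sum[of z 0 2] by auto
    then show "(if prong 1 z \<le> 0 then L 2 (max 0 (prong 2 z)) else L 1 (max 0 (prong 1 z))) = L 0 (max 0 (prong 0 z))"
      using z(2) centre by (simp add: max_def)
  next
    show "continuous_map (subtopology (top_of_set (cball 0 1)) {z \<in> topspace (top_of_set (cball 0 1)). prong 0 z \<le> 0}) X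
      (\<lambda>z. if prong 1 z \<le> 0 then L 2 (max 0 (prong 2 z)) else L 1 (max 0 (prong 1 z)))"
      unfolding subtopology_subtopology by (rule inner) auto
    show "continuous_map (subtopology (top_of_set (cball 0 1)) {z \<in> topspace (top_of_set (cball 0 1)). 0 \<le> prong 0 z}) X
        (\<lambda>z. L 0 (max 0 (prong 0 z)))"
      unfolding subtopology_subtopology by (rule leg) auto
  qed (auto intro!: cont_prong)
  moreover have "\<psi> z = v \<or> (\<exists>j s. j < 3 \<and> 0 < s \<and> s \<le> 1/2 \<and> \<psi> z = L j s)" if "cmod z \<le> 1" for z
  proof (cases "\<forall>j<3. prong j z \<le> 0")
    case False
    then obtain j where "j < 3" "prong j z > 0" by auto
    then show ?thesis using on_leg[OF that] prong_bounds[OF that] by blast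
  qed (use at_centre in auto)
  moreover
  have half: "\<psi> z \<noteq> \<psi> (- z)" if z: "cmod z = 1" and j: "j < 3" "prong j z > 0" for z j
  proof -
    have z': "cmod z \<le> 1" "cmod (- z) \<le> 1" using z by auto
    note on = on_leg[OF z'(1) j]
    have le: "prong j z \<le> 1/2" using prong_bounds[OF z'(1)] by blast
    show ?thesis
    proof (cases "\<exists>i<3. prong i (- z) > 0")
      case True
      then obtain i where i: "i < 3" "prong i (- z) > 0" by blast
      have "i \<noteq> j" using i(2) j(2) prong_uminus[of j z] by auto
      then show ?thesis
        using on on_leg[OF z'(2) i] disjoint[OF j(1) i(1) j(2) le i(2)] prong_bounds[OF z'(2)] by metis
    next
      case False
      then have "\<psi> (- z) = v" by (intro at_centre) (meson not_less)
      then show ?thesis using on off_centre[OF j le] by simp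
    qed
  qed
  have "\<psi> z \<noteq> \<psi> (- z)" if "cmod z = 1" for z
    using prong_antipodal[OF that] half[of z] half[of "- z"] that by (metis minus_minus norm_minus_cancel)
  ultimately show ?thesis using that by blast
qed

definition half_edges :: "'e set \<Rightarrow> ('e \<Rightarrow> real \<Rightarrow> 'a) \<Rightarrow> 'a \<Rightarrow> ('e \<times> bool) set" where
  "half_edges E \<phi> v = {e \<in> E. \<phi> e 0 = v} \<times> {False} \<union> {e \<in> E. \<phi> e 1 = v} \<times> {True}"

text \<open>Half edges cover only the outer quarters of an edge, so that those at different vertices
  are disjoint and the middle of every edge stays free.\<close>

definition half_edge_param :: "bool \<Rightarrow> real \<Rightarrow> real" where
  "half_edge_param b s = (if b then 1 - s / 2 else s / 2)"

context cw_graph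
begin

lemma open_cells_meet:
  assumes "e \<in> E" "e' \<in> E" "s \<in> {0<..<1}" "s' \<in> {0<..<1}" "\<phi> e s = \<phi> e' s'"
  shows "e = e' \<and> s = s'"
proof -
  have "e = e'"
    using edges_disjoint assms unfolding disjoint_family_on_def by blast
  moreover have "inj_on (\<phi> e) {0<..<1}"
    using homeomorphic_imp_injective_map[OF char_map_homeo[OF assms(1)]] by simp
  ultimately show ?thesis
    using assms by (auto dest: inj_onD)
qed

text \<open>Three half edges at each essential vertex form the tripods. The points \<open>w q\<close> are parking places for
particles, in the middle of some edge.\<close>

lemma disjoint_disks_at_essential_vertices:
  obtains \<psi> :: "'a \<Rightarrow> complex \<Rightarrow> 'a" and w :: "nat \<Rightarrow> 'a"
  where "\<And>v. v \<in> essential_vertices V E \<phi> \<Longrightarrow> continuous_map (top_of_set (cball 0 1)) X (\<psi> v)"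
    and "\<And>v z. \<lbrakk>v \<in> essential_vertices V E \<phi>; cmod z = 1\<rbrakk> \<Longrightarrow> \<psi> v z \<noteq> \<psi> v (- z)"
    and "\<And>v v' z z'. \<lbrakk>v \<in> essential_vertices V E \<phi>; v' \<in> essential_vertices V E \<phi>; v \<noteq> v';
            cmod z \<le> 1; cmod z' \<le> 1\<rbrakk> \<Longrightarrow> \<psi> v z \<noteq> \<psi> v' z'"
    and "\<And>q. w q \<in> topspace X" and "inj w"
    and "\<And>v z q. \<lbrakk>v \<in> essential_vertices V E \<phi>; cmod z \<le> 1\<rbrakk> \<Longrightarrow> \<psi> v z \<noteq> w q"
proof -
  define germ where "germ v = insert v {\<phi> e (half_edge_param b s) |e b s. (e, b) \<in> half_edges E \<phi> v \<and> 0 < s \<and> s \<le> 1/2}" for v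
  have param: "half_edge_param b s \<in> {0<..<1}" "half_edge_param b s \<le> 1/4 \<or> 3/4 \<le> half_edge_param b s"
    if "0 < s" "s \<le> 1/2" for b s
    using that by (auto simp: half_edge_param_def)
  have param_inj: "b = b'" if "half_edge_param b s = half_edge_param b' s'" "0 < s" "s \<le> 1/2" "0 < s'" "s' \<le> 1/2"
    for b b' s s'
    using that by (auto simp: half_edge_param_def split: if_splits)
  have end_unique: "v = v'" if "(e, b) \<in> half_edges E \<phi> v" "(e, b) \<in> half_edges E \<phi> v'" for e b v v'
    using that by (auto simp: half_edges_def)
  have in_E: "e \<in> E" if "(e, b) \<in> half_edges E \<phi> v" for e b v
    using that by (auto simp: half_edges_def)
  have not_V: "\<phi> e t \<notin> V" if "e \<in> E" "t \<in> {0<..<1}" for e t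
    using vertices_disjoint_edges[OF that(1)] that(2) by blast
  have half_edge_unique: "(e, b) = (e', b')"
    if "(e, b) \<in> half_edges E \<phi> v" "(e', b') \<in> half_edges E \<phi> v'"
      "\<phi> e (half_edge_param b s) = \<phi> e' (half_edge_param b' s')"
      "0 < s" "s \<le> 1/2" "0 < s'" "s' \<le> 1/2" for e b v e' b' v' s s'
    using open_cells_meet[OF in_E[OF that(1)] in_E[OF that(2)] param(1)[OF that(4,5)] param(1)[OF that(6,7)] that(3)]
      param_inj[of b s b' s'] that by auto
  have germ_disjoint: "v = v'" if x: "x \<in> germ v" "x \<in> germ v'" and V: "v \<in> V" "v' \<in> V" for v v' x
  proof (cases "x \<in> V")
    case True
    then have "x = v" "x = v'"
      using x not_V in_E param(1) unfolding germ_def by blast+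
    then show ?thesis by simp
  next
    case False
    then have "x \<noteq> v" "x \<noteq> v'" using V by auto
    then obtain e b s e' b' s' where "(e, b) \<in> half_edges E \<phi> v" "(e', b') \<in> half_edges E \<phi> v'"
      "x = \<phi> e (half_edge_param b s)" "x = \<phi> e' (half_edge_param b' s')" "0 < s" "s \<le> 1/2" "0 < s'" "s' \<le> 1/2"
      using x unfolding germ_def by blast
    then show ?thesis
      using half_edge_unique[of e b v e' b' v' s s'] end_unique by (metis prod.inject)
  qed
  have "\<exists>\<psi>. continuous_map (top_of_set (cball 0 1)) X \<psi> \<and> (\<forall>z. cmod z = 1 \<longrightarrow> \<psi> z \<noteq> \<psi> (- z))
       \<and> (\<forall>z. cmod z \<le> 1 \<longrightarrow> \<psi> z \<in> germ v)" if v: "v \<in> essential_vertices V E \<phi>" for v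
  proof -
    have "v \<in> V" using v by (simp add: essential_vertices_def)
    have fin: "finite (half_edges E \<phi> v)"
      using finite_edges by (auto simp: half_edges_def)
    have "card (half_edges E \<phi> v) = valence E \<phi> v"
      unfolding half_edges_def valence_def using finite_edges
      by (subst card_Un_disjoint) auto
    then have "card {..<3::nat} \<le> card (half_edges E \<phi> v)"
      using v by (simp add: essential_vertices_def)
    then obtain H where H: "inj_on H {..<3::nat}" "H ` {..<3} \<subseteq> half_edges E \<phi> v"
      using card_le_inj[of "{..<3::nat}" "half_edges E \<phi> v"] fin by auto
    have H_in: "(fst (H j), snd (H j)) \<in> half_edges E \<phi> v" if "j < 3" for j
      using H(2) that by auto
    define L where "L j s = \<phi> (fst (H j)) (half_edge_param (snd (H j)) s)" for j s
    obtain \<psi> where \<psi>: "continuous_map (top_of_set (cball 0 1)) X \<psi>"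
      "\<And>z. cmod z = 1 \<Longrightarrow> \<psi> z \<noteq> \<psi> (- z)"
      "\<And>z. cmod z \<le> 1 \<Longrightarrow> \<psi> z = v \<or> (\<exists>j s. j < 3 \<and> 0 < s \<and> s \<le> 1/2 \<and> \<psi> z = L j s)"
    proof (rule disk_to_tripod[of X L v])
      fix j :: nat assume j: "j < 3"
      have "continuous_map (top_of_set {0..1/2}) (top_of_set {0..1}) (half_edge_param (snd (H j)))"
        unfolding half_edge_param_def by (auto intro!: continuous_intros)
      then have "continuous_map (top_of_set {0..1/2}) X (\<phi> (fst (H j)) \<circ> half_edge_param (snd (H j)))"
        by (rule continuous_map_compose[OF _ char_map_continuous[OF in_E[OF H_in[OF j]]]])
      then show "continuous_map (top_of_set {0..1/2}) X (L j)"
        by (simp add: L_def[abs_def] o_def)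
      show "L j 0 = v"
        using H_in[OF j] by (auto simp: L_def half_edge_param_def half_edges_def)
      show "L j s \<noteq> v" if "0 < s" "s \<le> 1/2" for s
        using not_V[OF in_E[OF H_in[OF j]] param(1)[OF that]] \<open>v \<in> V\<close> by (auto simp: L_def)
    next
      fix i j :: nat and s t :: real
      assume ij: "i < 3" "j < 3" and st: "0 < s" "s \<le> 1/2" "0 < t" "t \<le> 1/2" "L i s = L j t"
      have "H i = H j"
        using half_edge_unique[OF H_in[OF ij(1)] H_in[OF ij(2)], of s t] st by (simp add: L_def)
      then show "i = j" using H(1) ij by (auto dest: inj_onD)
    qed blast
    moreover have "\<psi> z \<in> germ v" if "cmod z \<le> 1" for z
      using \<psi>(3)[OF that] H_in unfolding germ_def L_def by blast
    ultimately show ?thesis by blast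
  qed
  then obtain \<psi> where \<psi>: "\<And>v. v \<in> essential_vertices V E \<phi> \<Longrightarrow>
      continuous_map (top_of_set (cball 0 1)) X (\<psi> v) \<and> (\<forall>z. cmod z = 1 \<longrightarrow> \<psi> v z \<noteq> \<psi> v (- z))
       \<and> (\<forall>z. cmod z \<le> 1 \<longrightarrow> \<psi> v z \<in> germ v)"
    by metis
  obtain e0 where e0: "e0 \<in> E" using dimension_one by blast
  \<comment> \<open>Any injective sequence in the open interval from \<open>1/4\<close> to \<open>3/4\<close> would do.\<close>
  define p where "p q = 1/2 + 1 / (real q + 5)" for q :: nat
  have p: "1/4 < p q" "p q < 3/4" for q
    by (auto simp: p_def field_simps)
  have p01: "p q \<in> {0<..<1}" for q using p[of q] by auto
  have inj: "inj (\<lambda>q. \<phi> e0 (p q))"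
  proof (rule injI)
    fix q q' assume "\<phi> e0 (p q) = \<phi> e0 (p q')"
    then have "p q = p q'" using open_cells_meet[OF e0 e0 p01 p01] by blast
    then show "q = q'" by (simp add: p_def)
  qed
  have apart: "\<phi> e0 (p q) \<notin> germ v" if "v \<in> V" for q v
  proof
    assume "\<phi> e0 (p q) \<in> germ v"
    moreover have "\<phi> e0 (p q) \<noteq> v"
      using not_V[OF e0 p01] that by blast
    ultimately obtain e b s where eb: "(e, b) \<in> half_edges E \<phi> v" "0 < s" "s \<le> 1/2"
      "\<phi> e0 (p q) = \<phi> e (half_edge_param b s)"
      unfolding germ_def by blast
    then have "p q = half_edge_param b s"
      using open_cells_meet[OF e0 in_E[OF eb(1)] p01 param(1)[OF eb(2,3)]] by blast
    then show False
      using param(2)[OF eb(2,3), of b] p[of q] by auto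
  qed
  show ?thesis
  proof (rule that[of \<psi> "\<lambda>q. \<phi> e0 (p q)"])
    show "\<phi> e0 (p q) \<in> topspace X" for q
      using cells_cover e0 p01[of q] by blast
    show "\<psi> v z \<noteq> \<psi> v' z'" if "v \<in> essential_vertices V E \<phi>" "v' \<in> essential_vertices V E \<phi>" "v \<noteq> v'"
            "cmod z \<le> 1" "cmod z' \<le> 1" for v v' z z'
      using germ_disjoint[of "\<psi> v z" v v'] \<psi>[OF that(1)] \<psi>[OF that(2)] that
      by (auto simp: essential_vertices_def)
    show "\<psi> v z \<noteq> \<phi> e0 (p q)" if "v \<in> essential_vertices V E \<phi>" "cmod z \<le> 1" for v z q
      using apart[of v q] \<psi>[OF that(1)] that by (auto simp: essential_vertices_def)
  qed (use \<psi> inj in blast)+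
qed

end

section \<open>Tori of configurations\<close>

lemma cis_two_pi_add_Ints: "z \<in> \<int> \<Longrightarrow> cis (2 * pi * (t + z)) = cis (2 * pi * t)"
  by (auto elim!: Ints_cases simp: distrib_left cis_mult[symmetric] cis_multiple_2pi)

text \<open>The data that a planar graph with at least \<open>m\<close> essential vertices provides: the maps \<open>\<psi> l\<close> of the unit disk to
tripods, the parking places \<open>w q\<close>, and the embedding \<open>f\<close> into the plane.\<close>

locale disk_arrangement =
  fixes X :: "'a topology" and m k :: nat
    and \<psi> :: "nat \<Rightarrow> complex \<Rightarrow> 'a" and w :: "nat \<Rightarrow> 'a" and f :: "'a \<Rightarrow> complex"
  assumes disk_continuous: "\<And>l. l < m \<Longrightarrow> continuous_map (top_of_set (cball 0 1)) X (\<psi> l)"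
    and disk_antipodal: "\<And>l z. \<lbrakk>l < m; cmod z = 1\<rbrakk> \<Longrightarrow> \<psi> l z \<noteq> \<psi> l (- z)"
    and disks_disjoint: "\<And>l l' z z'. \<lbrakk>l < m; l' < m; l \<noteq> l'; cmod z \<le> 1; cmod z' \<le> 1\<rbrakk> \<Longrightarrow> \<psi> l z \<noteq> \<psi> l' z'"
    and spot_in: "\<And>q. w q \<in> topspace X" and spot_inj: "inj w"
    and disk_spot: "\<And>l z q. \<lbrakk>l < m; cmod z \<le> 1\<rbrakk> \<Longrightarrow> \<psi> l z \<noteq> w q"
    and planar_continuous: "continuous_map X euclidean f"
    and planar_inj: "inj_on f (topspace X)"

definition is_matching :: "nat \<Rightarrow> nat \<Rightarrow> (nat \<Rightarrow> nat) \<Rightarrow> (nat \<Rightarrow> nat) \<Rightarrow> bool" where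
  "is_matching m k A B \<longleftrightarrow> inj_on A {..<m} \<and> inj_on B {..<m} \<and> A ` {..<m} \<inter> B ` {..<m} = {}
     \<and> A ` {..<m} \<union> B ` {..<m} \<subseteq> {..<k}"

text \<open>The particles \<open>A l\<close> and \<open>B l\<close> live on the \<open>l\<close>th disk, at antipodal points of its boundary circle, and the
unmatched particles are parked. The site of a particle is the map on the disk that describes where it
lives (a constant map for a parked particle).\<close>

definition site :: "nat \<Rightarrow> (nat \<Rightarrow> complex \<Rightarrow> 'a) \<Rightarrow> (nat \<Rightarrow> 'a) \<Rightarrow> (nat \<Rightarrow> nat) \<Rightarrow> (nat \<Rightarrow> nat) \<Rightarrow> nat \<Rightarrow> complex \<Rightarrow> 'a" where
  "site m \<psi> w A B q = (if q \<in> A ` {..<m} then \<psi> (inv_into {..<m} A q)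
     else if q \<in> B ` {..<m} then \<psi> (inv_into {..<m} B q) else (\<lambda>_. w q))"

definition phase :: "nat \<Rightarrow> (nat \<Rightarrow> nat) \<Rightarrow> (nat \<Rightarrow> nat) \<Rightarrow> nat \<Rightarrow> (nat \<Rightarrow> real) \<Rightarrow> complex" where
  "phase m A B q y = (if q \<in> A ` {..<m} then cis (2 * pi * y (inv_into {..<m} A q))
     else - cis (2 * pi * y (inv_into {..<m} B q)))"

definition config_torus :: "nat \<Rightarrow> nat \<Rightarrow> (nat \<Rightarrow> complex \<Rightarrow> 'a) \<Rightarrow> (nat \<Rightarrow> 'a) \<Rightarrow> (nat \<Rightarrow> nat) \<Rightarrow> (nat \<Rightarrow> nat)
    \<Rightarrow> (nat \<Rightarrow> real) \<Rightarrow> nat \<Rightarrow> 'a" where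
  "config_torus m k \<psi> w A B y = (\<lambda>q\<in>{..<k}. site m \<psi> w A B q (phase m A B q y))"

lemma norm_phase: "cmod (phase m A B q y) = 1"
  by (simp add: phase_def)

lemma continuous_on_phase: "continuous_on S (phase m A B q)"
proof -
  have "continuous_on S (\<lambda>y. cis (2 * pi * y i))" for i
    by (intro continuous_on_cis continuous_intros continuous_on_subset[OF continuous_on_product_coordinates]) auto
  then show ?thesis
    unfolding phase_def by (cases "q \<in> A ` {..<m}") (auto intro: continuous_intros)
qed

lemma phase_periodic: "(\<And>j. z j \<in> \<int>) \<Longrightarrow> phase m A B q (\<lambda>j. y j + z j) = phase m A B q y"
  by (simp add: phase_def cis_two_pi_add_Ints)

context disk_arrangement
begin

lemma disk_in: "l < m \<Longrightarrow> cmod z \<le> 1 \<Longrightarrow> \<psi> l z \<in> topspace X"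
  using funcset_mem[OF continuous_map_funspace[OF disk_continuous], of l z] by simp

lemma site_continuous: "continuous_map (top_of_set (cball 0 1)) X (site m \<psi> w A B q)"
proof -
  have "inv_into {..<m} C q < m" if "q \<in> C ` {..<m}" for C
    using inv_into_into[OF that] by simp
  then show ?thesis
    using spot_in by (auto simp: site_def intro!: disk_continuous)
qed

lemma site_in: "cmod z \<le> 1 \<Longrightarrow> site m \<psi> w A B q z \<in> topspace X"
  using funcset_mem[OF continuous_map_funspace[OF site_continuous], of z] by simp

lemma site_left: "is_matching m k A B \<Longrightarrow> l < m \<Longrightarrow> site m \<psi> w A B (A l) = \<psi> l"
  and site_right: "is_matching m k A B \<Longrightarrow> l < m \<Longrightarrow> site m \<psi> w A B (B l) = \<psi> l"
  and phase_left: "is_matching m k A B \<Longrightarrow> l < m \<Longrightarrow> phase m A B (A l) y = cis (2 * pi * y l)"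
  and phase_right: "is_matching m k A B \<Longrightarrow> l < m \<Longrightarrow> phase m A B (B l) y = - cis (2 * pi * y l)"
  by (auto simp: is_matching_def site_def phase_def)

text \<open>Particles that do not form a pair never share a disk. Unlike distinctness of their positions, this
holds for independent phases \<open>z\<close> and \<open>z'\<close>, also inside of the disk.\<close>

lemma sites_disjoint:
  assumes AB: "is_matching m k A B" and "a \<noteq> b" and unmatched: "\<And>l. l < m \<Longrightarrow> {a, b} \<noteq> {A l, B l}"
    and z: "cmod z \<le> 1" "cmod z' \<le> 1"
  shows "site m \<psi> w A B a z \<noteq> site m \<psi> w A B b z'"
proof -
  define on_disk where "on_disk q l \<longleftrightarrow> l < m \<and> (q = A l \<or> q = B l)" for q l
  have on: "site m \<psi> w A B q = \<psi> l" if "on_disk q l" for q l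
    using that site_left[OF AB] site_right[OF AB] by (auto simp: on_disk_def)
  have off: "site m \<psi> w A B q = (\<lambda>_. w q)" if "\<nexists>l. on_disk q l" for q
    using that by (auto simp: site_def on_disk_def)
  consider l l' where "on_disk a l" "on_disk b l'" | l where "on_disk a l" "\<nexists>l. on_disk b l"
    | l where "on_disk b l" "\<nexists>l. on_disk a l" | "\<nexists>l. on_disk a l" "\<nexists>l. on_disk b l"
    by blast
  then show ?thesis
  proof cases
    case 1
    then have "l < m" "l' < m" by (auto simp: on_disk_def)
    moreover have "l \<noteq> l'"
      using 1 \<open>a \<noteq> b\<close> unmatched[of l] by (auto simp: on_disk_def)
    ultimately show ?thesis
      using disks_disjoint[of l l' z z'] z by (simp add: on[OF 1(1)] on[OF 1(2)])
  next
    case 2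
    then show ?thesis using disk_spot[of l z b] z by (simp add: on[OF 2(1)] off[OF 2(2)] on_disk_def)
  next
    case 3
    then show ?thesis using disk_spot[of l z' a] z by (simp add: on[OF 3(1)] off[OF 3(2)] on_disk_def)
  next
    case 4
    then show ?thesis using spot_inj \<open>a \<noteq> b\<close> by (simp add: off inj_eq)
  qed
qed

lemma sites_distinct:
  assumes AB: "is_matching m k A B" and "a \<noteq> b"
  shows "site m \<psi> w A B a (phase m A B a y) \<noteq> site m \<psi> w A B b (phase m A B b y)"
proof (cases "\<exists>l<m. {a, b} = {A l, B l}")
  case True
  then obtain l where l: "l < m" "a = A l \<and> b = B l \<or> a = B l \<and> b = A l"
    by (auto simp: doubleton_eq_iff)
  have "\<psi> l (cis (2 * pi * y l)) \<noteq> \<psi> l (- cis (2 * pi * y l))"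
    by (rule disk_antipodal[OF l(1)]) simp
  then show ?thesis
    using l by (auto simp: site_left[OF AB] site_right[OF AB] phase_left[OF AB] phase_right[OF AB])
next
  case False
  then show ?thesis
    using \<open>a \<noteq> b\<close> by (intro sites_disjoint[OF AB]) (auto simp: norm_phase)
qed

lemma config_torus_continuous:
  assumes AB: "is_matching m k A B"
  shows "continuous_map euclidean (Conf k X) (config_torus m k \<psi> w A B)"
  unfolding Conf_def continuous_map_in_subtopology
proof
  have "continuous_map euclidean X (\<lambda>y. site m \<psi> w A B q (phase m A B q y))" for q
  proof (rule continuous_map_compose[OF _ site_continuous, unfolded o_def])
    show "continuous_map euclidean (top_of_set (cball 0 1)) (phase m A B q)"
      by (simp add: continuous_map_in_subtopology continuous_map_iff_continuous2 continuous_on_phase norm_phase)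
  qed
  then show "continuous_map euclidean (power_topology k X) (config_torus m k \<psi> w A B)"
    unfolding power_topology_def continuous_map_componentwise
    by (auto simp: config_torus_def)
  show "config_torus m k \<psi> w A B \<in> topspace euclidean \<rightarrow> {x. inj_on x {..<k}}"
  proof (intro Pi_I CollectI inj_onI)
    fix y q q'
    assume "q \<in> {..<k}" "q' \<in> {..<k}" "config_torus m k \<psi> w A B y q = config_torus m k \<psi> w A B y q'"
    then show "q = q'"
      using sites_distinct[OF AB, of q q' y] by (cases "q = q'") (simp_all add: config_torus_def)
  qed
qed

lemma config_torus_periodic:
  "(\<And>j. z j \<in> \<int>) \<Longrightarrow> config_torus m k \<psi> w A B (\<lambda>j. y j + z j) = config_torus m k \<psi> w A B y"
  by (simp add: config_torus_def phase_periodic)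

text \<open>Up to homotopy, this is the map \<open>Conf k X \<rightarrow> Conf 2 \<complex> \<simeq> S\<^sup>1\<close> that forgets all particles but \<open>a\<close> and \<open>b\<close>. It
is here that planarity is used.\<close>

definition displacement :: "nat \<Rightarrow> nat \<Rightarrow> (nat \<Rightarrow> 'a) \<Rightarrow> complex" where
  "displacement a b x = f (x a) - f (x b)"

lemma displacement_continuous:
  assumes "a < k" "b < k"
  shows "continuous_map (Conf k X) euclidean (displacement a b)"
proof -
  have "continuous_map (Conf k X) euclidean (\<lambda>x. f (x q))" if "q < k" for q
    using that unfolding Conf_def power_topology_def
    by (intro continuous_map_compose[OF _ planar_continuous, unfolded o_def]
        continuous_map_from_subtopology continuous_map_product_projection) auto
  then show ?thesis
    using assms unfolding displacement_def by (intro continuous_map_diff) auto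
qed

lemma displacement_nonzero:
  assumes "a < k" "b < k" "a \<noteq> b" "x \<in> topspace (Conf k X)"
  shows "displacement a b x \<noteq> 0"
proof -
  have "x a \<in> topspace X" "x b \<in> topspace X" "x a \<noteq> x b"
    using assms by (auto simp: Conf_def power_topology_def dest: inj_onD)
  then show ?thesis using planar_inj by (auto simp: displacement_def dest: inj_onD)
qed

text \<open>A half turn exchanges the two particles of a pair, so they wind around each other an odd number of times.\<close>

lemma displacement_matched:
  assumes AB: "is_matching m k A B" and l: "l < m"
  obtains L and d :: int where "continuous_on UNIV L" "d \<noteq> 0"
    "\<And>y. exp (L (y l)) = displacement (A l) (B l) (config_torus m k \<psi> w A B y)"
    "\<And>t. L (t + 1) = L t + 2 * pi * of_int d * \<i>"
proof -
  define c where "c t = f (\<psi> l (cis (2 * pi * t))) - f (\<psi> l (- cis (2 * pi * t)))" for t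
  have f\<psi>: "continuous_on (cball 0 1) (\<lambda>z. f (\<psi> l z))"
    using continuous_map_compose[OF disk_continuous[OF l] planar_continuous] by (simp add: o_def)
  have "continuous_on UNIV c"
    unfolding c_def by (intro continuous_intros continuous_on_compose2[OF f\<psi>] continuous_on_cis) auto
  moreover have "c t \<noteq> 0" for t
    using disk_antipodal[OF l, of "cis (2 * pi * t)"] planar_inj disk_in[OF l]
    by (auto simp: c_def dest: inj_onD)
  moreover have "c (t + 1/2) = - c t" for t
  proof -
    have "cis (2 * pi * (t + 1/2)) = - cis (2 * pi * t)"
      by (simp add: distrib_left cis_mult[symmetric])
    then show ?thesis by (simp add: c_def)
  qed
  ultimately obtain L and d :: int where L: "continuous_on UNIV L" "\<And>t. exp (L t) = c t"
    "\<And>t. L (t + 1) = L t + 2 * pi * of_int d * \<i>" "d \<noteq> 0"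
    using log_of_antiperiodic_loop by metis
  have "A l < k" "B l < k" using AB l by (auto simp: is_matching_def)
  then have "exp (L (y l)) = displacement (A l) (B l) (config_torus m k \<psi> w A B y)" for y
    using l by (simp add: L(2) c_def displacement_def config_torus_def
        site_left[OF AB] site_right[OF AB] phase_left[OF AB] phase_right[OF AB])
  then show ?thesis using that L by blast
qed

text \<open>The displacement of two particles that do not form a pair extends to a nowhere zero function on the product of
two disks. This product is convex, so there is a logarithm on all of it, and in terms of phases
the logarithm is periodic.\<close>

lemma displacement_unmatched:
  assumes AB: "is_matching m k A B" and ab: "a < k" "b < k" "a \<noteq> b"
    and unmatched: "\<And>l. l < m \<Longrightarrow> {a, b} \<noteq> {A l, B l}"
  obtains \<rho> :: "(nat \<Rightarrow> real) \<Rightarrow> complex" where "continuous_on UNIV \<rho>"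
    "\<And>y. exp (\<rho> y) = displacement a b (config_torus m k \<psi> w A B y)"
    "\<And>y z. (\<And>j. z j \<in> \<int>) \<Longrightarrow> \<rho> (\<lambda>j. y j + z j) = \<rho> y"
proof -
  let ?D = "cball 0 1 \<times> cball 0 1 :: (complex \<times> complex) set"
  have f_site: "continuous_on (cball 0 1) (\<lambda>z. f (site m \<psi> w A B q z))" for q
    using continuous_map_compose[OF site_continuous planar_continuous] by (simp add: o_def)
  have "continuous_on ?D (\<lambda>p. f (site m \<psi> w A B a (fst p)) - f (site m \<psi> w A B b (snd p)))"
    by (intro continuous_intros continuous_on_compose2[OF f_site]) auto
  moreover have "contractible ?D"
    by (intro convex_imp_contractible convex_Times convex_cball)
  moreover have "f (site m \<psi> w A B a (fst p)) - f (site m \<psi> w A B b (snd p)) \<noteq> 0" if "p \<in> ?D" for p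
    using that sites_disjoint[OF AB ab(3) unmatched, of "fst p" "snd p"] planar_inj site_in
    by (auto dest: inj_onD)
  ultimately have "\<exists>h. continuous_on ?D h \<and>
      (\<forall>p\<in>?D. f (site m \<psi> w A B a (fst p)) - f (site m \<psi> w A B b (snd p)) = exp (h p))"
    by (rule continuous_logarithm_on_contractible) auto
  then obtain h where h: "continuous_on ?D h"
    "\<And>p. p \<in> ?D \<Longrightarrow> f (site m \<psi> w A B a (fst p)) - f (site m \<psi> w A B b (snd p)) = exp (h p)"
    by blast
  show ?thesis
  proof (rule that[of "\<lambda>y. h (phase m A B a y, phase m A B b y)"])
    show "continuous_on UNIV (\<lambda>y. h (phase m A B a y, phase m A B b y))"
      by (intro continuous_on_compose2[OF h(1)] continuous_intros continuous_on_phase) (auto simp: norm_phase)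
    show "exp (h (phase m A B a y, phase m A B b y)) = displacement a b (config_torus m k \<psi> w A B y)" for y
      using h(2)[of "(phase m A B a y, phase m A B b y)"] ab
      by (simp add: norm_phase displacement_def config_torus_def)
  qed (simp add: phase_periodic)
qed

text \<open>On the first of the \<open>r\<close> factors the pairs are \<open>{0,1}, {2,3}, \<dots>\<close>, on all others they are \<open>{1,2}, {3,4}, \<dots>\<close>,
where \<open>k\<close> is read as \<open>0\<close>. The \<open>m\<close> pairs that rotate on a factor give \<open>m\<close> displacements, which are each
compared with a factor on which that pair does not rotate.\<close>

theorem TC_Conf_lower_bound:
  assumes r: "r \<ge> 2" and k: "k \<ge> 3" "2 * m \<le> k"
  shows "enat (r * m) \<le> TC r (Conf k X)"
proof -
  define A0 B0 A1 B1 where "A0 = (\<lambda>l::nat. 2 * l)" and "B0 = (\<lambda>l::nat. 2 * l + 1)"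
    and "A1 = (\<lambda>l::nat. 2 * l + 1)" and "B1 = (\<lambda>l::nat. if 2 * l + 2 = k then 0 else 2 * l + 2)"
  have M0: "is_matching m k A0 B0"
    using k by (auto simp: is_matching_def A0_def B0_def inj_on_def) presburger
  have M1: "is_matching m k A1 B1"
    using k by (auto simp: is_matching_def A1_def B1_def inj_on_def split: if_splits) presburger
  \<comment> \<open>The two matchings have no pair in common; for \<open>k = 2\<close> the pairs \<open>{0,1}\<close> and \<open>{1,0}\<close> would agree.\<close>
  have cross: "{A0 l, B0 l} \<noteq> {A1 l', B1 l'}" if "l < m" "l' < m" for l l'
    using k that by (auto simp: A0_def B0_def A1_def B1_def doubleton_eq_iff split: if_splits) presburger
  define A B where "A = (\<lambda>j::nat. if j = 0 then A0 else A1)" and "B = (\<lambda>j::nat. if j = 0 then B0 else B1)"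
  have M: "is_matching m k (A j) (B j)" for j
    using M0 M1 by (simp add: A_def B_def)
  define other :: "nat \<Rightarrow> nat" where "other j = (if j = 0 then 1 else 0)" for j
  have unmatched: "{A j l, B j l} \<noteq> {A (other j) l', B (other j) l'}" if "l < m" "l' < m" for j l l'
    using cross[OF that] cross[OF that(2,1)] by (auto simp: A_def B_def other_def)
  \<comment> \<open>Coordinate \<open>i = j * m + l\<close> of the torus is the phase of the \<open>l\<close>th pair on the \<open>j\<close>th factor.\<close>
  define block where "block j x = (\<lambda>l. x (j * m + l))" for j :: nat and x :: "nat \<Rightarrow> real"
  have block_continuous: "continuous_on UNIV (block j)" for j
    unfolding block_def by (intro continuous_on_coordinatewise_then_product) auto
  define \<Phi> where "\<Phi> x = (\<lambda>j\<in>{..<r}. config_torus m k \<psi> w (A j) (B j) (block j x))" for x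
  have idx: "i mod m < m" "i div m < r" "i div m * m + i mod m = i" "A (i div m) (i mod m) < k" "B (i div m) (i mod m) < k"
     "A (i div m) (i mod m) \<noteq> B (i div m) (i mod m)" "other (i div m) < r" if "i < r * m" for i
  proof -
    show lm: "i mod m < m" using that by (cases m) auto
    show "i div m < r" using that by (simp add: less_mult_imp_div_less)
    show "A (i div m) (i mod m) < k" "B (i div m) (i mod m) < k" "A (i div m) (i mod m) \<noteq> B (i div m) (i mod m)"
      using M[of "i div m"] lm unfolding is_matching_def by blast+
    show "other (i div m) < r" using r by (simp add: other_def)
  qed simp
  define pair where "pair i = displacement (A (i div m) (i mod m)) (B (i div m) (i mod m))" for i
  define is_log where "is_log i L d \<longleftrightarrow> continuous_on UNIV L \<and> (d :: int) \<noteq> 0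
      \<and> (\<forall>y. exp (L (y (i mod m))) = pair i (config_torus m k \<psi> w (A (i div m)) (B (i div m)) y))
      \<and> (\<forall>t. L (t + 1) = L t + 2 * pi * of_int d * \<i>)" for i L d
  define is_periodic_log where "is_periodic_log i \<rho> \<longleftrightarrow> continuous_on UNIV \<rho>
      \<and> (\<forall>y. exp (\<rho> y) = pair i (config_torus m k \<psi> w (A (other (i div m))) (B (other (i div m))) y))
      \<and> (\<forall>y z. (\<forall>j. z j \<in> \<int>) \<longrightarrow> \<rho> (\<lambda>j. y j + z j) = \<rho> y)" for i \<rho>
  have "\<exists>L d. is_log i L d" if "i < r * m" for i
    unfolding is_log_def pair_def by (rule displacement_matched[OF M[of "i div m"] idx(1)[OF that]]) blast
  then obtain L d where L: "\<And>i. i < r * m \<Longrightarrow> is_log i (L i) (d i)"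
    by metis
  have "\<exists>\<rho>. is_periodic_log i \<rho>" if "i < r * m" for i
    unfolding is_periodic_log_def pair_def
    by (rule displacement_unmatched[OF M[of "other (i div m)"] idx(4,5,6)[OF that] unmatched[OF idx(1)[OF that]]]) blast+
  then obtain \<rho> where \<rho>: "\<And>i. i < r * m \<Longrightarrow> is_periodic_log i (\<rho> i)"
    by metis
  show ?thesis
  proof (rule TC_lower_bound_from_torus[of r "Conf k X" \<Phi> "r * m"
        pair "\<lambda>i. i div m" "\<lambda>i. other (i div m)"
        L d "\<lambda>i x. \<rho> i (block (other (i div m)) x)"])
    show "continuous_map euclidean (power_topology r (Conf k X)) \<Phi>"
      unfolding power_topology_def continuous_map_componentwise
    proof (intro conjI ballI)
      fix j assume j: "j \<in> {..<r}"
      have "continuous_map euclidean (Conf k X) (config_torus m k \<psi> w (A j) (B j) \<circ> block j)"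
        using block_continuous by (intro continuous_map_compose[OF _ config_torus_continuous[OF M]]) simp
      then show "continuous_map euclidean (Conf k X) (\<lambda>x. \<Phi> x j)"
        using j by (simp add: \<Phi>_def o_def)
    qed (auto simp: \<Phi>_def)
    show "\<Phi> (\<lambda>j. x j + z j) = \<Phi> x" if "\<And>j. z j \<in> \<int>" for x z
      using config_torus_periodic that by (simp add: \<Phi>_def block_def)
    show "exp (L i (x i)) = pair i (\<Phi> x (i div m))"
      if "i < r * m" for i x
    proof -
      have "x i = block (i div m) x (i mod m)" using idx(3)[OF that] by (simp only: block_def)
      then show ?thesis using L[OF that] idx(2)[OF that] by (simp add: \<Phi>_def is_log_def)
    qed
    show "exp (\<rho> i (block (other (i div m)) x)) = pair i (\<Phi> x (other (i div m)))"
      if "i < r * m" for i x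
      using \<rho>[OF that] idx(7)[OF that] by (simp add: \<Phi>_def is_periodic_log_def)
    show "continuous_on UNIV (\<lambda>x. \<rho> i (block (other (i div m)) x))" if "i < r * m" for i
    proof -
      have "continuous_on UNIV (\<rho> i)" using \<rho>[OF that] by (simp add: is_periodic_log_def)
      then show ?thesis by (rule continuous_on_compose2[OF _ block_continuous]) simp
    qed
    show "\<rho> i (block (other (i div m)) (\<lambda>j. x j + z j)) = \<rho> i (block (other (i div m)) x)"
      if "i < r * m" "\<And>j. z j \<in> \<int>" for i x z
      using \<rho>[OF that(1)] that(2) by (simp add: block_def is_periodic_log_def)
  qed (use r idx L in \<open>auto simp: is_log_def pair_def displacement_continuous displacement_nonzero\<close>)
qed

end

section \<open>Planar graphs\<close>

theorem theorem7p1: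
  fixes X :: "'a topology" and V :: "'a set" and E :: "'e set"
    and \<phi> :: "'e \<Rightarrow> real \<Rightarrow> 'a" and r k :: nat
  assumes "cw_graph X V E \<phi>"
    and "connected_space X"
    and "planar X"
    and "r \<ge> 2"
    and "k \<ge> 4"
  shows "TC r (Conf k X) \<ge> enat (r * min (k div 2) (card (essential_vertices V E \<phi>)))"
proof -
  interpret cw_graph X V E \<phi> by fact
  define m where "m = min (k div 2) (card (essential_vertices V E \<phi>))"
  have "finite (essential_vertices V E \<phi>)"
    using finite_vertices by (simp add: essential_vertices_def)
  then obtain v where "bij_betw v {0..<card (essential_vertices V E \<phi>)} (essential_vertices V E \<phi>)"
    using ex_bij_betw_nat_finite by blast
  then have v: "v l \<in> essential_vertices V E \<phi>" "\<lbrakk>l' < m; l \<noteq> l'\<rbrakk> \<Longrightarrow> v l \<noteq> v l'" if "l < m" for l l'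
    using that by (auto simp: m_def bij_betw_def inj_on_def)
  obtain \<psi> w where \<psi>: "\<And>v. v \<in> essential_vertices V E \<phi> \<Longrightarrow> continuous_map (top_of_set (cball 0 1)) X (\<psi> v)"
      "\<And>v z. \<lbrakk>v \<in> essential_vertices V E \<phi>; cmod z = 1\<rbrakk> \<Longrightarrow> \<psi> v z \<noteq> \<psi> v (- z)"
      "\<And>v v' z z'. \<lbrakk>v \<in> essential_vertices V E \<phi>; v' \<in> essential_vertices V E \<phi>; v \<noteq> v';
            cmod z \<le> 1; cmod z' \<le> 1\<rbrakk> \<Longrightarrow> \<psi> v z \<noteq> \<psi> v' z'"
    and w: "\<And>q :: nat. w q \<in> topspace X" "inj w"
      "\<And>v z q. \<lbrakk>v \<in> essential_vertices V E \<phi>; cmod z \<le> 1\<rbrakk> \<Longrightarrow> \<psi> v z \<noteq> w q"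
    using disjoint_disks_at_essential_vertices by blast
  obtain f :: "'a \<Rightarrow> real ^ 2" where f: "embedding_map X euclidean f"
    using \<open>planar X\<close> by (auto simp: planar_def)
  have f_cont: "continuous_map X euclidean f"
    using f embedding_map_def homeomorphic_imp_continuous_map continuous_map_in_subtopology by blast
  have f_inj: "inj_on f (topspace X)"
    using f unfolding embedding_map_def by (rule homeomorphic_imp_injective_map)
  define F where "F x = Complex (f x $ 1) (f x $ 2)" for x
  have "continuous_on UNIV (\<lambda>u :: real ^ 2. Complex (u $ 1) (u $ 2))"
    unfolding Complex_eq by (intro continuous_intros)
  then have F_cont: "continuous_map X euclidean F"
    using continuous_map_compose[OF f_cont, of euclidean "\<lambda>u. Complex (u $ 1) (u $ 2)"]
    by (simp add: F_def[abs_def] o_def)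
  have F_inj: "inj_on F (topspace X)"
    using f_inj by (auto simp: inj_on_def F_def vec_eq_iff forall_2)
  interpret disk_arrangement X m k "\<lambda>l. \<psi> (v l)" w F
    by unfold_locales (use \<psi> w v F_cont F_inj in auto)
  show ?thesis
    using TC_Conf_lower_bound[of r] assms(4,5) unfolding m_def[symmetric] by (simp add: m_def)
qed

end
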